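(* Let $(X,d)$ be a metric space, let $\mathbf{B}$ be one of the spaces $B_m(X)$, $C_b(X)$, $C_c(X)$ with the supremum norm, let $\Gamma:\mathbf{B}\to\mathbb{R}$ be a pressure function and let $\varphi\in\mathbf{B}$. Then $\Gamma$ is Gateaux differentiable at $\varphi$ if and only if there exists a unique tangent functional in $\mathcal{T}_\varphi(\Gamma)$.
   Context: $B_m(X)$ is the space of bounded Borel measurable functions $X\to\mathbb{R}$; $C_b(X)$ the space of bounded continuous functions $X\to\mathbb{R}$; $C_c(X)$ the space of continuous functions with compact support; all with the norm $\|\varphi\|_\infty=\sup_{x\in X}|\varphi(x)|$. A function $\Gamma:\mathbf{B}\to\mathbb{R}$ is a pressure function if it satisfies, for all $\varphi,\psi\in\mathbf{B}$, $c\in\mathbb{R}$, $t\in[0,1]$: (C1) monotonicity: $\varphi\leqslant\psi\Rightarrow\Gamma(\varphi)\leqslant\Gamma(\psi)$; (C2) translation invariance: $\Gamma(\varphi+c)=\Gamma(\varphi)+c$ (this presupposes $\varphi+c\in\mathbf{B}$); (C3) convexity: $\Gamma(t\varphi+(1-t)\psi)\leqslant t\Gamma(\varphi)+(1-t)\Gamma(\psi)$. $\mathcal{P}_a(X)$ is the set of finitely additive probability measures on the Borel $\sigma$-algebra of $X$ (finitely additive, non-negative, $\mu(X)=1$; also regular when $\mathbf{B}=C_b(X)$ or $C_c(X)$; no regularity is required when $\mathbf{B}=B_m(X)$), identified through $\mu\leftrightarrow(\varphi\mapsto\int\varphi\,d\mu)$ with the positive normalized elements of the topological dual of $\mathbf{B}$.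 $\mathcal{T}_\varphi(\Gamma)$ is the set of tangent functionals to $\Gamma$ at $\varphi$, i.e. of all $\mu\in\mathcal{P}_a(X)$ with $\Gamma(\varphi+\psi)-\Gamma(\varphi)\geqslant\int\psi\,d\mu$ for every $\psi\in\mathbf{B}$. $\Gamma$ is Gateaux differentiable at $\varphi$ if the limit $\lim_{t\to0}\frac1t[\Gamma(\varphi+t\psi)-\Gamma(\varphi)]$ exists and is finite for every $\psi\in\mathbf{B}$.
   Formalization: For C_b(X) the regular finitely additive measures live on the field generated by the open sets, not the Borel σ-algebra, where they need not represent the dual and the claim fails (remote points of βR). Pressure functions on C_c(X) require φ+c∈C_c(X), so X is compact there. *)

theory Defs
  imports "HOL-Analysis.Analysis"
begin

section \<open>The function spaces\<close>

datatype fun_space = Bm | Cb | Cc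

text \<open>\<^const>\<open>Cb\<close> uses the library's set \<open>bcontfun\<close> of bounded continuous functions.\<close>

primrec carrier_of :: "fun_space \<Rightarrow> ('a::metric_space \<Rightarrow> real) set" where
  "carrier_of Bm = {f \<in> borel_measurable borel. bounded (range f)}"
| "carrier_of Cb = bcontfun"
| "carrier_of Cc = {f. continuous_on UNIV f \<and> compact (closure {x. f x \<noteq> 0})}"

section \<open>Pressure functions and Gateaux differentiability\<close>

text \<open>
  Translation invariance includes the requirement that \<open>B\<close> is closed under adding constants.
  For \<^term>\<open>carrier_of Cc\<close> this forces the underlying space to be compact.
\<close>

definition pressure_function ::
    "('a \<Rightarrow> real) set \<Rightarrow> (('a \<Rightarrow> real) \<Rightarrow> real) \<Rightarrow> bool" where
  "pressure_function B \<Gamma> \<longleftrightarrow>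
     (\<forall>\<phi>\<in>B. \<forall>\<psi>\<in>B. (\<forall>x. \<phi> x \<le> \<psi> x) \<longrightarrow> \<Gamma> \<phi> \<le> \<Gamma> \<psi>) \<and>
     (\<forall>\<phi>\<in>B. \<forall>c. (\<lambda>x. \<phi> x + c) \<in> B \<and> \<Gamma> (\<lambda>x. \<phi> x + c) = \<Gamma> \<phi> + c) \<and>
     (\<forall>\<phi>\<in>B. \<forall>\<psi>\<in>B. \<forall>t\<in>{0..1}.
        \<Gamma> (\<lambda>x. t * \<phi> x + (1 - t) * \<psi> x) \<le> t * \<Gamma> \<phi> + (1 - t) * \<Gamma> \<psi>)"

definition gateaux_differentiable_at ::
    "('a \<Rightarrow> real) set \<Rightarrow> (('a \<Rightarrow> real) \<Rightarrow> real) \<Rightarrow> ('a \<Rightarrow> real) \<Rightarrow> bool" where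
  "gateaux_differentiable_at B \<Gamma> \<phi> \<longleftrightarrow>
     (\<forall>\<psi>\<in>B. \<exists>l::real.
        ((\<lambda>t. (1 / t) * (\<Gamma> (\<lambda>x. \<phi> x + t * \<psi> x) - \<Gamma> \<phi>)) \<longlongrightarrow> l) (at 0))"

section \<open>Finitely additive probability measures\<close>

text \<open>
  A set function on \<open>M\<close> is represented by a total function that is fixed outside \<open>M\<close>
  (\<^const>\<open>extensional\<close>), so that equality of such functions is equality on \<open>M\<close>.
\<close>

definition prob_charges :: "'a set set \<Rightarrow> ('a set \<Rightarrow> real) set" where
  "prob_charges M =
     {\<mu> \<in> extensional M. additive M \<mu> \<and> (\<forall>A\<in>M. 0 \<le> \<mu> A) \<and> \<mu> UNIV = 1}"

text \<open>
  Regularity of finitely additive set functions in the sense of Dunford and Schwartz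
  (Linear Operators I, III.5): every member of \<open>M\<close> is approximated by closed sets from inside
  and open sets from outside.  Here \<open>M\<close> is meant to contain all open and all closed sets.
\<close>

definition regular_charge :: "'a::topological_space set set \<Rightarrow> ('a set \<Rightarrow> real) \<Rightarrow> bool" where
  "regular_charge M \<mu> \<longleftrightarrow>
     (\<forall>A\<in>M. \<forall>\<epsilon>>0. \<exists>F G. closed F \<and> open G \<and> F \<subseteq> A \<and> A \<subseteq> G \<and> \<mu> (G - F) < \<epsilon>)"

text \<open>
  Integral with respect to a charge: the supremum of the lower sums over finite
  \<open>M\<close>-partitions.  If \<open>f\<close> is bounded and all sets \<open>{x. a < f x}\<close> lie in \<open>M\<close>, it equals the infimum
  of the upper sums, i.e. \<open>f\<close> is integrable and this is its integral; this covers all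
  integrands considered below.
\<close>

definition charge_integral :: "'a set set \<Rightarrow> ('a set \<Rightarrow> real) \<Rightarrow> ('a \<Rightarrow> real) \<Rightarrow> real" where
  "charge_integral M \<mu> f =
     (SUP P\<in>{P. finite P \<and> P \<subseteq> M \<and> partition_on UNIV P}. \<Sum>A\<in>P. \<mu> A * (INF x\<in>A. f x))"

text \<open>
  The sets on which the measures are defined.  For bounded continuous functions on a
  non-compact space, regular finitely additive measures represent the dual when they live on the
  field generated by the open sets (Dunford and Schwartz, IV.6.2), and not when regularity
  is asked for on the whole Borel \<open>\<sigma>\<close>-algebra: evaluation at a remote point of the Stone-Cech
  compactification of the real line is not given by any regular charge on all Borel sets, since
  the rationals and the irrationals would both be null sets.
\<close>

primrec domain_of :: "fun_space \<Rightarrow> 'a::metric_space set set" where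
  "domain_of Bm = sets borel"
| "domain_of Cb = algebra UNIV hull {U. open U}"
| "domain_of Cc = sets borel"

definition Pa :: "fun_space \<Rightarrow> ('a::metric_space set \<Rightarrow> real) set" where
  "Pa S = {\<mu> \<in> prob_charges (domain_of S). S \<noteq> Bm \<longrightarrow> regular_charge (domain_of S) \<mu>}"

definition tangent_functionals ::
    "fun_space \<Rightarrow> (('a::metric_space \<Rightarrow> real) \<Rightarrow> real) \<Rightarrow> ('a \<Rightarrow> real) \<Rightarrow> ('a set \<Rightarrow> real) set" where
  "tangent_functionals S \<Gamma> \<phi> =
     {\<mu> \<in> Pa S. \<forall>\<psi>\<in>carrier_of S.
        \<Gamma> (\<lambda>x. \<phi> x + \<psi> x) - \<Gamma> \<phi> \<ge> charge_integral (domain_of S) \<mu> \<psi>}"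

end

theory Submission
  imports Defs
begin

text \<open>
  Let \<open>D \<psi>\<close> be the right derivative of \<open>t \<mapsto> \<Gamma> (\<phi> + t * \<psi>)\<close> at \<open>0\<close>.  Convexity makes the difference quotients
  monotone, and monotonicity with translation invariance makes them bounded, so \<open>D\<close> is finite; it is
  sublinear, and \<open>\<Gamma>\<close> is Gateaux differentiable at \<open>\<phi>\<close> if and only if \<open>D\<close> is odd
  (\<open>gateaux_iff_right_deriv_odd\<close>).  A linear functional is tangent to \<open>\<Gamma>\<close> at \<open>\<phi>\<close> if and only if it lies
  below \<open>D\<close>, and it is then automatically positive and normalized.  If \<open>D\<close> is odd, a linear functional
  below \<open>D\<close> equals \<open>D\<close>.  If \<open>D\<close> is not odd, then \<open>D (- \<psi>) \<noteq> - D \<psi>\<close> for some \<open>\<psi>\<close>, and the Hahn-Banach theorem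
  (\<open>Hahn_Banach_touching\<close>) gives a functional that touches \<open>D\<close> at \<open>\<psi>\<close> and another that touches it at
  \<open>- \<psi>\<close>.  So differentiability means uniqueness of the tangent functional
  (\<open>gateaux_iff_unique_tangent\<close>).

  It remains to identify the positive normalized functionals with charges, in both directions.  For
  bounded Borel functions the charge is given by the values at indicators.  For bounded continuous
  functions it is constructed as in the Riesz representation theorem, with finite unions in place
  of countable ones: the functional defines a content on open sets, its outer extension is additive on
  the Caratheodory sets, and these form an algebra that contains the open sets
  (\<open>regular_representation\<close>).  A regular charge is determined by its integrals because of
  Urysohn functions (\<open>regular_charges_eqI\<close>).  That the functional is indeed the integral is proved in
  both cases by cutting a function into thin horizontal layers (\<open>charge_integral_eqI\<close>).

  Finally, a pressure function on \<open>carrier_of Cc\<close> exists only if the space is compact.  Then the carrier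
  consists of all continuous functions, and compactness makes the outer extension countably subadditive, so
  that every Borel set is a Caratheodory set (\<open>borel_Caratheodory\<close>).
\<close>

section \<open>The Hahn-Banach theorem by minimal sublinear functionals\<close>

locale function_space =
  fixes B :: "('a \<Rightarrow> real) set"
  assumes zero_mem: "(\<lambda>x. 0) \<in> B"
    and add_mem: "\<And>f g. f \<in> B \<Longrightarrow> g \<in> B \<Longrightarrow> (\<lambda>x. f x + g x) \<in> B"
    and scale_mem: "\<And>f c. f \<in> B \<Longrightarrow> (\<lambda>x. c * f x) \<in> B"
begin

lemma uminus_mem: "f \<in> B \<Longrightarrow> (\<lambda>x. - f x) \<in> B"
  using scale_mem[of f "-1"] by simp

lemma diff_mem: "f \<in> B \<Longrightarrow> g \<in> B \<Longrightarrow> (\<lambda>x. f x - g x) \<in> B"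
  using add_mem[OF _ uminus_mem, of f g] by simp

definition sublinear_on :: "(('a \<Rightarrow> real) \<Rightarrow> real) \<Rightarrow> bool" where
  "sublinear_on p \<longleftrightarrow>
     (\<forall>f\<in>B. \<forall>g\<in>B. p (\<lambda>x. f x + g x) \<le> p f + p g) \<and>
     (\<forall>f\<in>B. \<forall>c>0. p (\<lambda>x. c * f x) \<le> c * p f)"

definition linear_on :: "(('a \<Rightarrow> real) \<Rightarrow> real) \<Rightarrow> bool" where
  "linear_on L \<longleftrightarrow>
     (\<forall>f\<in>B. \<forall>g\<in>B. L (\<lambda>x. f x + g x) = L f + L g) \<and>
     (\<forall>f\<in>B. \<forall>c. L (\<lambda>x. c * f x) = c * L f)"

lemma sublinear_onD:
  assumes "sublinear_on p"
  shows sublinear_on_add: "f \<in> B \<Longrightarrow> g \<in> B \<Longrightarrow> p (\<lambda>x. f x + g x) \<le> p f + p g"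
    and sublinear_on_scale: "f \<in> B \<Longrightarrow> c > 0 \<Longrightarrow> p (\<lambda>x. c * f x) = c * p f"
    and sublinear_on_zero: "p (\<lambda>x. 0) = 0"
    and sublinear_on_minus: "f \<in> B \<Longrightarrow> - p (\<lambda>x. - f x) \<le> p f"
proof -
  show add: "p (\<lambda>x. f x + g x) \<le> p f + p g" if "f \<in> B" "g \<in> B" for f g
    using assms that by (auto simp: sublinear_on_def)
  have le: "p (\<lambda>x. c * f x) \<le> c * p f" if "f \<in> B" "c > 0" for f c
    using assms that by (auto simp: sublinear_on_def)
  show "p (\<lambda>x. c * f x) = c * p f" if "f \<in> B" "c > 0" for f c
  proof (rule antisym)
    have "p f \<le> inverse c * p (\<lambda>x. c * f x)"
      using le[OF scale_mem[OF that(1)], of "inverse c" c] that by (simp add: field_simps)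
    then show "c * p f \<le> p (\<lambda>x. c * f x)"
      using that by (simp add: field_simps)
  qed (use le that in auto)
  show zero: "p (\<lambda>x. 0) = 0"
    using le[OF zero_mem, of 2] le[OF zero_mem, of "1/2"] by simp
  show "- p (\<lambda>x. - f x) \<le> p f" if "f \<in> B" for f
    using add[OF that uminus_mem[OF that]] zero by simp
qed

text \<open>
  For sublinear \<open>p\<close>, the largest sublinear functional below \<open>p\<close> whose value at \<open>- h\<close> is at most \<open>- p h\<close>:
  it is free to move any amount along \<open>h\<close> at the price \<open>p h\<close> per unit.
\<close>

definition slide :: "(('a \<Rightarrow> real) \<Rightarrow> real) \<Rightarrow> ('a \<Rightarrow> real) \<Rightarrow> ('a \<Rightarrow> real) \<Rightarrow> real" where
  "slide p h f = (INF t\<in>{0..}. p (\<lambda>x. f x + t * h x) - t * p h)"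

lemma slide_le:
  assumes p: "sublinear_on p" and h: "h \<in> B" and f: "f \<in> B" and t: "0 \<le> t"
  shows "slide p h f \<le> p (\<lambda>x. f x + t * h x) - t * p h"
proof -
  have "- p (\<lambda>x. - f x) \<le> p (\<lambda>x. f x + s * h x) - s * p h" if "0 \<le> s" for s
  proof (cases "s = 0")
    case True
    then show ?thesis using sublinear_on_minus[OF p f] by simp
  next
    case False
    have "s * p h = p (\<lambda>x. (f x + s * h x) + - f x)"
      using sublinear_on_scale[OF p h, of s] that False by simp
    also have "\<dots> \<le> p (\<lambda>x. f x + s * h x) + p (\<lambda>x. - f x)"
      by (intro sublinear_on_add p add_mem scale_mem uminus_mem f h)
    finally show ?thesis by simp
  qed
  then have "bdd_below ((\<lambda>t. p (\<lambda>x. f x + t * h x) - t * p h) ` {0..})"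
    by (intro bdd_belowI[of _ "- p (\<lambda>x. - f x)"]) auto
  then show ?thesis
    unfolding slide_def using t by (intro cINF_lower) auto
qed

lemma slide_greatest:
  "(\<And>t. 0 \<le> t \<Longrightarrow> c \<le> p (\<lambda>x. f x + t * h x) - t * p h) \<Longrightarrow> c \<le> slide p h f"
  unfolding slide_def by (intro cINF_greatest) auto

lemma slide_le_self: "sublinear_on p \<Longrightarrow> h \<in> B \<Longrightarrow> f \<in> B \<Longrightarrow> slide p h f \<le> p f"
  using slide_le[of p h f 0] by simp

lemma slide_minus: "sublinear_on p \<Longrightarrow> h \<in> B \<Longrightarrow> slide p h (\<lambda>x. - h x) \<le> - p h"
  using slide_le[of p h "\<lambda>x. - h x" 1] by (simp add: uminus_mem sublinear_on_zero)

text \<open>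
  Two movements along \<open>h\<close>, one for each summand, add up to one movement for the sum, and a
  movement can be rescaled; so sublinearity survives the infimum.
\<close>

lemma sublinear_on_slide:
  assumes p: "sublinear_on p" and h: "h \<in> B"
  shows "sublinear_on (slide p h)"
  unfolding sublinear_on_def
proof (intro conjI ballI allI impI)
  fix f g assume f: "f \<in> B" and g: "g \<in> B"
  have "slide p h (\<lambda>x. f x + g x) \<le>
      (p (\<lambda>x. f x + s * h x) - s * p h) + (p (\<lambda>x. g x + t * h x) - t * p h)"
    if "0 \<le> s" "0 \<le> t" for s t
  proof -
    have "p (\<lambda>x. (f x + s * h x) + (g x + t * h x)) \<le>
        p (\<lambda>x. f x + s * h x) + p (\<lambda>x. g x + t * h x)"
      by (intro sublinear_on_add p add_mem scale_mem f g h)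
    moreover have "(\<lambda>x. (f x + s * h x) + (g x + t * h x)) =
        (\<lambda>x. f x + g x + (s + t) * h x)"
      by (simp add: algebra_simps)
    ultimately show ?thesis
      using slide_le[OF p h add_mem[OF f g], of "s + t"] that by (simp add: algebra_simps)
  qed
  then have "slide p h (\<lambda>x. f x + g x) - (p (\<lambda>x. g x + t * h x) - t * p h) \<le> slide p h f"
    if "0 \<le> t" for t
    using that by (intro slide_greatest) (simp add: algebra_simps)
  then have "slide p h (\<lambda>x. f x + g x) - slide p h f \<le> slide p h g"
    by (intro slide_greatest) (simp add: algebra_simps)
  then show "slide p h (\<lambda>x. f x + g x) \<le> slide p h f + slide p h g"
    by simp
next
  fix f and c :: real assume f: "f \<in> B" and c: "c > 0"
  have "slide p h (\<lambda>x. c * f x) / c \<le> slide p h f"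
  proof (rule slide_greatest)
    fix t :: real assume t: "0 \<le> t"
    have "slide p h (\<lambda>x. c * f x) \<le> p (\<lambda>x. c * f x + (c * t) * h x) - (c * t) * p h"
      using slide_le[OF p h scale_mem[OF f, of c], of "c * t"] c t by simp
    also have "(\<lambda>x. c * f x + (c * t) * h x) = (\<lambda>x. c * (f x + t * h x))"
      by (simp add: algebra_simps)
    also have "p \<dots> = c * p (\<lambda>x. f x + t * h x)"
      by (intro sublinear_on_scale p add_mem scale_mem f h c)
    finally show "slide p h (\<lambda>x. c * f x) / c \<le> p (\<lambda>x. f x + t * h x) - t * p h"
      using c by (simp add: field_simps)
  qed
  then show "slide p h (\<lambda>x. c * f x) \<le> c * slide p h f"
    using c by (simp add: field_simps)
qed

text \<open>
  If sliding along \<open>g\<close> does not lower \<open>q\<close>, then the movement of length one gives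
  \<open>q f \<le> q (f + g) - q g\<close>, which is superadditivity.  Being additive as well as positively homogeneous,
  \<open>q\<close> is linear.
\<close>

lemma linear_on_if_minimal:
  assumes q: "sublinear_on q"
    and minimal: "\<And>h f. h \<in> B \<Longrightarrow> f \<in> B \<Longrightarrow> slide q h f = q f"
  shows "linear_on q"
proof -
  have add: "q (\<lambda>x. f x + g x) = q f + q g" if f: "f \<in> B" and g: "g \<in> B" for f g
    using slide_le[OF q g f, of 1] minimal[OF g f] sublinear_on_add[OF q f g] by simp
  have minus: "q (\<lambda>x. - f x) = - q f" if "f \<in> B" for f
    using add[OF that uminus_mem[OF that]] sublinear_on_zero[OF q] by simp
  have "q (\<lambda>x. c * f x) = c * q f" if f: "f \<in> B" for f c
  proof -
    consider "c > 0" | "c = 0" | "c < 0" by linarith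
    then show ?thesis
    proof cases
      case 3
      then have "q (\<lambda>x. (- c) * f x) = (- c) * q f"
        by (intro sublinear_on_scale[OF q f]) simp
      with minus[OF scale_mem[OF f, of "- c"]] show ?thesis by simp
    qed (use sublinear_on_scale[OF q f] sublinear_on_zero[OF q] in auto)
  qed
  with add show ?thesis
    unfolding linear_on_def by blast
qed

text \<open>
  Zorn's lemma applies because all sublinear functionals below \<open>p\<close> have the common pointwise lower
  bound \<open>- p (- f)\<close>, so a chain has a real-valued infimum, and because in a chain two members can be
  replaced by the smaller one, so this infimum is sublinear.
\<close>

lemma minimal_sublinear_exists:
  assumes p: "sublinear_on p"
  obtains q where "sublinear_on q" "\<And>f. f \<in> B \<Longrightarrow> q f \<le> p f"
    "\<And>h f. h \<in> B \<Longrightarrow> f \<in> B \<Longrightarrow> slide q h f = q f"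
proof -
  define A where "A = {q. sublinear_on q \<and> (\<forall>f\<in>B. q f \<le> p f) \<and> (\<forall>f. f \<notin> B \<longrightarrow> q f = 0)}"
  \<comment> \<open>Values off \<open>B\<close> are normalized to \<open>0\<close>, since the pointwise order must be antisymmetric.\<close>
  define restr where "restr = (\<lambda>(q :: ('a \<Rightarrow> real) \<Rightarrow> real) f. if f \<in> B then q f else 0)"
  have restr: "restr q \<in> A" if "sublinear_on q" "\<And>f. f \<in> B \<Longrightarrow> q f \<le> p f" for q
    using that add_mem scale_mem unfolding A_def restr_def sublinear_on_def by simp
  have "\<exists>m\<in>A. \<forall>a\<in>A. a \<le> m \<longrightarrow> a = m"
  proof (rule predicate_Zorn)
    show "partial_order_on A (relation_of (\<lambda>x y. y \<le> x) A)"
      by (rule partial_order_on_relation_ofI) auto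
    fix C assume C: "C \<in> Chains (relation_of (\<lambda>x y. y \<le> x) A)"
    then have CA: "C \<subseteq> A" and chain: "\<And>q r. q \<in> C \<Longrightarrow> r \<in> C \<Longrightarrow> q \<le> r \<or> r \<le> q"
      by (auto simp: Chains_def relation_of_def)
    show "\<exists>u\<in>A. \<forall>a\<in>C. u \<le> a"
    proof (cases "C = {}")
      case True
      then show ?thesis using restr[OF p] by auto
    next
      case ne: False
      define u where "u = (\<lambda>f. INF q\<in>C. q f)"
      have u_le: "u f \<le> q f" if q: "q \<in> C" and f: "f \<in> B" for q f
        unfolding u_def
      proof (rule cINF_lower[OF _ q])
        have "- p (\<lambda>x. - f x) \<le> r f" if "r \<in> C" for r
          using that CA sublinear_on_minus[of r f] f uminus_mem[OF f]
          unfolding A_def by (force dest: bspec)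
        then show "bdd_below ((\<lambda>q. q f) ` C)"
          by (intro bdd_belowI[of _ "- p (\<lambda>x. - f x)"]) auto
      qed
      have u_great: "c \<le> u f" if "\<And>q. q \<in> C \<Longrightarrow> c \<le> q f" for c f
        unfolding u_def using ne that by (intro cINF_greatest)
      have "sublinear_on u"
        unfolding sublinear_on_def
      proof (intro conjI ballI allI impI)
        fix f g assume f: "f \<in> B" and g: "g \<in> B"
        have "u (\<lambda>x. f x + g x) \<le> q f + r g" if q: "q \<in> C" and r: "r \<in> C" for q r
        proof -
          obtain s where s: "s \<in> C" "s \<le> q" "s \<le> r"
            using chain[OF q r] q r by auto
          have "u (\<lambda>x. f x + g x) \<le> s (\<lambda>x. f x + g x)"
            using u_le[OF s(1) add_mem[OF f g]] .
          also have "\<dots> \<le> s f + s g"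
            using s(1) CA f g by (auto simp: A_def intro: sublinear_on_add)
          also have "\<dots> \<le> q f + r g"
            using s by (intro add_mono) (auto simp: le_fun_def)
          finally show ?thesis .
        qed
        then have "u (\<lambda>x. f x + g x) - r g \<le> u f" if "r \<in> C" for r
          using that by (intro u_great) (simp add: algebra_simps)
        then have "u (\<lambda>x. f x + g x) - u f \<le> u g"
          by (intro u_great) (simp add: algebra_simps)
        then show "u (\<lambda>x. f x + g x) \<le> u f + u g" by simp
      next
        fix f and c :: real assume f: "f \<in> B" and c: "c > 0"
        have "u (\<lambda>x. c * f x) / c \<le> u f"
        proof (rule u_great)
          fix q assume q: "q \<in> C"
          have "u (\<lambda>x. c * f x) \<le> c * q f"
            using u_le[OF q scale_mem[OF f, of c]] q CA sublinear_on_scale[of q f c] f c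
            by (auto simp: A_def)
          then show "u (\<lambda>x. c * f x) / c \<le> q f"
            using c by (simp add: field_simps)
        qed
        then show "u (\<lambda>x. c * f x) \<le> c * u f"
          using c by (simp add: field_simps)
      qed
      moreover have "u f \<le> p f" if "f \<in> B" for f
      proof -
        obtain q where "q \<in> C" using ne by auto
        then show ?thesis
          using u_le[OF _ that, of q] CA that by (force simp: A_def)
      qed
      ultimately have "restr u \<in> A"
        by (rule restr)
      moreover have "restr u \<le> a" if "a \<in> C" for a
        using that CA u_le by (auto simp: le_fun_def restr_def A_def)
      ultimately show ?thesis by auto
    qed
  qed
  then obtain m where m: "m \<in> A" and min: "\<And>a. a \<in> A \<Longrightarrow> a \<le> m \<Longrightarrow> a = m"
    by auto
  have sm: "sublinear_on m" and mp: "\<And>f. f \<in> B \<Longrightarrow> m f \<le> p f"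
    using m by (auto simp: A_def)
  have "slide m h f = m f" if h: "h \<in> B" and f: "f \<in> B" for h f
  proof -
    have le: "slide m h g \<le> m g" if "g \<in> B" for g
      using slide_le_self[OF sm h that] .
    have "restr (slide m h) = m"
    proof (rule min)
      show "restr (slide m h) \<in> A"
        using le mp by (intro restr sublinear_on_slide sm h) (blast intro: order_trans)
      show "restr (slide m h) \<le> m"
        using le m by (auto simp: le_fun_def restr_def A_def)
    qed
    then show ?thesis
      using f by (auto simp: restr_def fun_eq_iff split: if_splits)
  qed
  with sm mp show ?thesis by (rule that)
qed

text \<open>
  Sliding \<open>p\<close> along \<open>h\<close> first lowers the value at \<open>- h\<close> to
  \<open>- p h\<close>, and any linear functional below the result must then take the value \<open>p h\<close> at \<open>h\<close>.
\<close>

theorem Hahn_Banach_touching: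
  assumes p: "sublinear_on p" and h: "h \<in> B"
  obtains L where "linear_on L" "\<And>f. f \<in> B \<Longrightarrow> L f \<le> p f" "L h = p h"
proof -
  obtain L where L: "sublinear_on L" "\<And>f. f \<in> B \<Longrightarrow> L f \<le> slide p h f"
      "\<And>h f. h \<in> B \<Longrightarrow> f \<in> B \<Longrightarrow> slide L h f = L f"
    using minimal_sublinear_exists[OF sublinear_on_slide[OF p h]] by blast
  have lin: "linear_on L"
    using L(1,3) by (rule linear_on_if_minimal)
  have le: "L f \<le> p f" if "f \<in> B" for f
    using L(2)[OF that] slide_le_self[OF p h that] by simp
  have "L (\<lambda>x. - 1 * h x) = - 1 * L h"
    using lin h unfolding linear_on_def by blast
  then have "- L h \<le> - p h"
    using L(2)[OF uminus_mem[OF h]] slide_minus[OF p h] by simp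
  with le[OF h] have "L h = p h" by simp
  with lin le show ?thesis by (rule that)
qed

end

section \<open>Integrals with respect to charges\<close>

locale prob_charge = algebra UNIV M for M :: "'a set set" +
  fixes \<mu> :: "'a set \<Rightarrow> real"
  assumes charge: "\<mu> \<in> prob_charges M"
begin

lemma nonneg: "A \<in> M \<Longrightarrow> 0 \<le> \<mu> A"
  and total: "\<mu> UNIV = 1"
  and disjoint_Un: "A \<in> M \<Longrightarrow> C \<in> M \<Longrightarrow> A \<inter> C = {} \<Longrightarrow> \<mu> (A \<union> C) = \<mu> A + \<mu> C"
  using charge by (auto simp: prob_charges_def additive_def)

lemma null: "\<mu> {} = 0"
  using disjoint_Un[of "{}" "{}"] by simp

lemma Diff_eq: "A \<in> M \<Longrightarrow> C \<in> M \<Longrightarrow> C \<subseteq> A \<Longrightarrow> \<mu> (A - C) = \<mu> A - \<mu> C"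
  using disjoint_Un[of C "A - C"] Diff[of A C] by (simp add: Un_absorb1)

lemma mono: "A \<in> M \<Longrightarrow> C \<in> M \<Longrightarrow> C \<subseteq> A \<Longrightarrow> \<mu> C \<le> \<mu> A"
  using Diff_eq[of A C] nonneg[of "A - C"] Diff[of A C] by simp

lemma finite_disjoint_UN:
  assumes "finite I" "\<And>i. i \<in> I \<Longrightarrow> A i \<in> M" "disjoint_family_on A I"
  shows "\<mu> (\<Union>i\<in>I. A i) = (\<Sum>i\<in>I. \<mu> (A i))"
  using assms
proof (induction I rule: finite_induct)
  case empty
  then show ?case by (simp add: null)
next
  case (insert i I)
  have "A i \<inter> (\<Union>j\<in>I. A j) = {}"
    using insert.hyps insert.prems(2) by (fastforce simp: disjoint_family_on_def)
  moreover have "disjoint_family_on A I"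
    using insert.prems(2) by (auto simp: disjoint_family_on_def)
  moreover have "(\<Union>j\<in>I. A j) \<in> M"
    using insert by (intro finite_UN) auto
  ultimately show ?case
    using insert by (simp add: disjoint_Un)
qed

text \<open>
  Partitions are indexed families, and empty members are allowed, so that level sets of a function
  form one without removing empty sets or repetitions.
\<close>

definition finite_partition :: "'i set \<Rightarrow> ('i \<Rightarrow> 'a set) \<Rightarrow> bool" where
  "finite_partition I A \<longleftrightarrow>
     finite I \<and> (\<forall>i\<in>I. A i \<in> M) \<and> disjoint_family_on A I \<and> (\<Union>i\<in>I. A i) = UNIV"

lemma split_along_partition:
  assumes A: "finite_partition I A" and C: "C \<in> M"
  shows "\<mu> C = (\<Sum>i\<in>I. \<mu> (C \<inter> A i))"
proof -
  have "\<mu> (\<Union>i\<in>I. C \<inter> A i) = (\<Sum>i\<in>I. \<mu> (C \<inter> A i))"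
    using A C by (intro finite_disjoint_UN) (auto simp: finite_partition_def disjoint_family_on_def)
  moreover have "(\<Union>i\<in>I. C \<inter> A i) = C"
    using A by (auto simp: finite_partition_def)
  ultimately show ?thesis by simp
qed

text \<open>
  Pass to the common refinement \<open>A i \<inter> C j\<close>: on a nonempty piece \<open>a i \<le> b j\<close>, and empty pieces have
  charge zero.
\<close>

lemma lower_sum_le_upper_sum:
  assumes A: "finite_partition I A" and C: "finite_partition J C"
    and a: "\<And>i x. i \<in> I \<Longrightarrow> x \<in> A i \<Longrightarrow> a i \<le> f x"
    and b: "\<And>j x. j \<in> J \<Longrightarrow> x \<in> C j \<Longrightarrow> f x \<le> b j"
  shows "(\<Sum>i\<in>I. \<mu> (A i) * a i) \<le> (\<Sum>j\<in>J. \<mu> (C j) * b j)"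
proof -
  have "(\<Sum>i\<in>I. \<mu> (A i) * a i) = (\<Sum>i\<in>I. \<Sum>j\<in>J. \<mu> (A i \<inter> C j) * a i)"
    using A by (intro sum.cong refl)
      (auto simp: split_along_partition[OF C] sum_distrib_right finite_partition_def)
  also have "\<dots> \<le> (\<Sum>i\<in>I. \<Sum>j\<in>J. \<mu> (A i \<inter> C j) * b j)"
  proof (intro sum_mono)
    fix i j assume ij: "i \<in> I" "j \<in> J"
    show "\<mu> (A i \<inter> C j) * a i \<le> \<mu> (A i \<inter> C j) * b j"
    proof (cases "A i \<inter> C j = {}")
      case False
      then obtain x where "x \<in> A i" "x \<in> C j" by auto
      then have "a i \<le> b j" using a b ij by force
      moreover have "0 \<le> \<mu> (A i \<inter> C j)"
        using A C ij by (intro nonneg) (auto simp: finite_partition_def)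
      ultimately show ?thesis by (rule mult_left_mono)
    qed (simp add: null)
  qed
  also have "\<dots> = (\<Sum>j\<in>J. \<Sum>i\<in>I. \<mu> (C j \<inter> A i) * b j)"
    by (subst sum.swap) (simp add: Int_commute)
  also have "\<dots> = (\<Sum>j\<in>J. \<mu> (C j) * b j)"
    using C by (intro sum.cong refl)
      (auto simp: split_along_partition[OF A] sum_distrib_right finite_partition_def)
  finally show ?thesis .
qed

lemma finite_partition_of_partition_on:
  "finite P \<Longrightarrow> P \<subseteq> M \<Longrightarrow> partition_on UNIV P \<Longrightarrow> finite_partition P (\<lambda>A. A)"
  by (auto simp: finite_partition_def partition_on_def disjoint_family_on_def disjoint_def)

lemma finite_partition_trivial: "finite_partition {()} (\<lambda>_. UNIV)"
  by (auto simp: finite_partition_def disjoint_family_on_def)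

lemma INF_le_on:
  fixes f :: "'a \<Rightarrow> real"
  assumes "bounded (range f)" "x \<in> A"
  shows "(INF x\<in>A. f x) \<le> f x"
  using assms by (intro cINF_lower bounded_imp_bdd_below) (auto intro: bounded_subset)

text \<open>
  Together with the next lemma this replaces the definition of the integral: bounds of the
  integrand on the members of a finite partition give bounds of the integral.
\<close>

lemma charge_integral_le:
  assumes f: "bounded (range f)" and C: "finite_partition J C"
    and b: "\<And>j x. j \<in> J \<Longrightarrow> x \<in> C j \<Longrightarrow> f x \<le> b j"
  shows "charge_integral M \<mu> f \<le> (\<Sum>j\<in>J. \<mu> (C j) * b j)"
  unfolding charge_integral_def
proof (rule cSUP_least)
  have "partition_on UNIV {UNIV :: 'a set}"
    by (auto simp: partition_on_def disjoint_def)
  then have "{UNIV} \<in> {P. finite P \<and> P \<subseteq> M \<and> partition_on UNIV P}"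
    using top by simp
  then show "{P. finite P \<and> P \<subseteq> M \<and> partition_on UNIV P} \<noteq> {}"
    by (metis empty_iff)
  fix P assume "P \<in> {P. finite P \<and> P \<subseteq> M \<and> partition_on UNIV P}"
  then show "(\<Sum>A\<in>P. \<mu> A * (INF x\<in>A. f x)) \<le> (\<Sum>j\<in>J. \<mu> (C j) * b j)"
    using INF_le_on[OF f] b
    by (intro lower_sum_le_upper_sum[OF finite_partition_of_partition_on C]) auto
qed

lemma le_charge_integral:
  assumes f: "bounded (range f)" and A: "finite_partition I A"
    and a: "\<And>i x. i \<in> I \<Longrightarrow> x \<in> A i \<Longrightarrow> a i \<le> f x"
  shows "(\<Sum>i\<in>I. \<mu> (A i) * a i) \<le> charge_integral M \<mu> f"
proof -
  define J where "J = {i\<in>I. A i \<noteq> {}}"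
  define P where "P = A ` J"
  have inj: "inj_on A J"
    using A by (fastforce simp: J_def inj_on_def finite_partition_def disjoint_family_on_def)
  have "disjoint P"
    using A by (fastforce simp: P_def J_def finite_partition_def disjoint_def disjoint_family_on_def)
  moreover have "\<Union>P = UNIV"
    using A by (auto simp: P_def J_def finite_partition_def) (metis UN_E UNIV_I empty_iff)
  ultimately have P: "P \<in> {P. finite P \<and> P \<subseteq> M \<and> partition_on UNIV P}"
    using A by (auto simp: P_def J_def finite_partition_def partition_on_def)
  have "(\<Sum>i\<in>I. \<mu> (A i) * a i) = (\<Sum>i\<in>J. \<mu> (A i) * a i)"
    using A by (intro sum.mono_neutral_right) (auto simp: J_def null finite_partition_def)
  also have "\<dots> \<le> (\<Sum>i\<in>J. \<mu> (A i) * (INF x\<in>A i. f x))"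
    using A a by (intro sum_mono mult_left_mono cINF_greatest nonneg)
      (auto simp: J_def finite_partition_def)
  also have "\<dots> = (\<Sum>A\<in>P. \<mu> A * (INF x\<in>A. f x))"
    unfolding P_def using inj by (simp add: sum.reindex)
  also have "\<dots> \<le> charge_integral M \<mu> f"
    unfolding charge_integral_def
  proof (rule cSUP_upper[OF P])
    obtain K where K: "\<And>x. \<bar>f x\<bar> \<le> K"
      using f by (auto simp: bounded_iff)
    have "(\<Sum>A\<in>Q. \<mu> A * (INF x\<in>A. f x)) \<le> (\<Sum>j\<in>{()}. \<mu> UNIV * K)"
      if "finite Q" "Q \<subseteq> M" "partition_on UNIV Q" for Q
      using that INF_le_on[OF f] K
      by (intro lower_sum_le_upper_sum[OF finite_partition_of_partition_on
            finite_partition_trivial, of Q _ f]) (auto simp: abs_le_iff)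
    then show "bdd_above ((\<lambda>P. \<Sum>A\<in>P. \<mu> A * (INF x\<in>A. f x)) `
        {P. finite P \<and> P \<subseteq> M \<and> partition_on UNIV P})"
      by (intro bdd_aboveI2) auto
  qed
  finally show ?thesis .
qed

lemma le_charge_integral_of_set:
  assumes "bounded (range f)" "A \<in> M" "\<And>x. indicator A x \<le> f x"
  shows "\<mu> A \<le> charge_integral M \<mu> f"
proof -
  have "finite_partition UNIV (\<lambda>b. if b then A else - A)"
    using assms(2) compl_sets[of A]
    by (auto simp: finite_partition_def disjoint_family_on_def Compl_eq_Diff_UNIV)
  then have "(\<Sum>b\<in>UNIV. \<mu> (if b then A else - A) * of_bool b) \<le> charge_integral M \<mu> f"
  proof (rule le_charge_integral[OF assms(1)])
    show "of_bool b \<le> f x" if "x \<in> (if b then A else - A)" for b x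
      using assms(3)[of x] that by (auto split: if_splits)
  qed
  then show ?thesis by (simp add: UNIV_bool)
qed

lemma charge_integral_le_of_set:
  assumes "bounded (range f)" "A \<in> M" "\<And>x. f x \<le> indicator A x"
  shows "charge_integral M \<mu> f \<le> \<mu> A"
proof -
  have "finite_partition UNIV (\<lambda>b. if b then A else - A)"
    using assms(2) compl_sets[of A]
    by (auto simp: finite_partition_def disjoint_family_on_def Compl_eq_Diff_UNIV)
  then have "charge_integral M \<mu> f \<le> (\<Sum>b\<in>UNIV. \<mu> (if b then A else - A) * of_bool b)"
  proof (rule charge_integral_le[OF assms(1)])
    show "f x \<le> of_bool b" if "x \<in> (if b then A else - A)" for b x
      using assms(3)[of x] that by (auto split: if_splits)
  qed
  then show ?thesis by (simp add: UNIV_bool)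
qed

definition level :: "('a \<Rightarrow> real) \<Rightarrow> real \<Rightarrow> real \<Rightarrow> nat \<Rightarrow> 'a set" where
  "level f c \<delta> i = {x. c + real i * \<delta> \<le> f x}"

text \<open>
  The set where \<open>c + i * \<delta> \<le> f x < c + (i + 1) * \<delta>\<close>, written as a difference so that it lies in the
  algebra as soon as the superlevel sets of \<open>f\<close> do.
\<close>

definition slab :: "('a \<Rightarrow> real) \<Rightarrow> real \<Rightarrow> real \<Rightarrow> nat \<Rightarrow> 'a set" where
  "slab f c \<delta> i = level f c \<delta> i - level f c \<delta> (Suc i)"

lemma finite_partition_slab:
  assumes meas: "\<And>r. {x. r \<le> f x} \<in> M"
    and \<delta>: "0 < \<delta>" and low: "\<And>x. c \<le> f x" and up: "\<And>x. f x < c + real n * \<delta>"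
  shows "finite_partition {..<n} (slab f c \<delta>)"
  unfolding finite_partition_def
proof (intro conjI ballI)
  fix i show "slab f c \<delta> i \<in> M"
    unfolding slab_def level_def by (intro Diff meas)
next
  have *: False if "i < j" "x \<in> slab f c \<delta> i" "x \<in> slab f c \<delta> j" for i j x
  proof -
    have "real (Suc i) * \<delta> \<le> real j * \<delta>"
      using that(1) \<delta> by (intro mult_right_mono) auto
    then show False
      using that by (auto simp: slab_def level_def)
  qed
  then show "disjoint_family_on (slab f c \<delta>) {..<n}"
    unfolding disjoint_family_on_def by (metis disjoint_iff linorder_neqE_nat)
  have "\<exists>i<n. x \<in> slab f c \<delta> i" for x
  proof -
    define k where "k = (LEAST k. f x < c + real k * \<delta>)"
    have k: "f x < c + real k * \<delta>" and kn: "k \<le> n"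
      unfolding k_def using up[of x] by (auto intro: LeastI Least_le)
    have "k \<noteq> 0"
      using k low[of x] by (intro notI) simp
    then obtain i where i: "k = Suc i"
      by (cases k) auto
    have "\<not> f x < c + real i * \<delta>"
      using not_less_Least[of i "\<lambda>k. f x < c + real k * \<delta>"] i unfolding k_def by simp
    then have "x \<in> slab f c \<delta> i"
      using k i by (auto simp: slab_def level_def)
    then show ?thesis using i kn by (auto simp: Suc_le_eq)
  qed
  then show "(\<Union>i\<in>{..<n}. slab f c \<delta> i) = UNIV"
    by auto
qed auto

lemma slab_bounds:
  "x \<in> slab f c \<delta> i \<Longrightarrow> c + real i * \<delta> \<le> f x"
  "x \<in> slab f c \<delta> i \<Longrightarrow> f x \<le> c + real i * \<delta> + \<delta>"
  by (auto simp: slab_def level_def algebra_simps)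

lemma bounded_grid:
  assumes "bounded (range f)" "\<epsilon> > 0"
  obtains c \<delta> n where "0 < \<delta>" "\<delta> \<le> \<epsilon>" "\<And>x. c \<le> f x" "\<And>x. f x < c + real n * \<delta>"
proof -
  obtain K where K: "\<And>x. \<bar>f x\<bar> \<le> K"
    using assms(1) by (auto simp: bounded_iff)
  obtain n where n: "2 * K < real n * \<epsilon>"
    using ex_less_of_nat_mult[OF assms(2)] by blast
  have "f x < - K + real n * \<epsilon>" "- K \<le> f x" for x
    using n K[of x] by (auto simp: abs_le_iff)
  then show ?thesis
    using assms(2) by (intro that[of \<epsilon> "- K" n]) auto
qed

text \<open>
  The integral is defined by lower sums alone, so for \<open>t < 0\<close> homogeneity holds only because upper
  sums approximate it equally well.  Measurability provides a partition on which \<open>f\<close> varies by at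
  most \<open>\<epsilon>\<close>; with the values \<open>a i\<close> on it, both integrals are close to the same sum, up to the factor \<open>t\<close>.
\<close>

lemma charge_integral_scale:
  assumes f: "bounded (range f)" and meas: "\<And>r. {x. r \<le> f x} \<in> M"
  shows "charge_integral M \<mu> (\<lambda>x. t * f x) = t * charge_integral M \<mu> f"
proof -
  have tf: "bounded (range (\<lambda>x. t * f x))"
    using bounded_scaling[OF f, of t] by (simp add: image_image)
  have close: "\<bar>charge_integral M \<mu> (\<lambda>x. t * f x) - t * charge_integral M \<mu> f\<bar> \<le> 2 * \<bar>t\<bar> * \<epsilon>"
    if "\<epsilon> > 0" for \<epsilon>
  proof -
    obtain c \<delta> n where g: "0 < \<delta>" "\<delta> \<le> \<epsilon>" "\<And>x. c \<le> f x" "\<And>x. f x < c + real n * \<delta>"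
      using bounded_grid[OF f \<open>\<epsilon> > 0\<close>] by metis
    define A where "A = slab f c \<delta>"
    define a where "a = (\<lambda>i. c + real i * \<delta>)"
    have A: "finite_partition {..<n} A"
      unfolding A_def by (rule finite_partition_slab[OF meas g(1,3,4)])
    have a: "a i \<le> f x" "f x \<le> a i + \<epsilon>" if "x \<in> A i" for i x
      using slab_bounds[of x f c \<delta> i] that g(2) by (auto simp: A_def a_def)
    have ones: "(\<Sum>i<n. \<mu> (A i)) = 1"
      using split_along_partition[OF A top] total by simp
    define s where "s = (\<Sum>i<n. \<mu> (A i) * a i)"
    have shift: "(\<Sum>i<n. \<mu> (A i) * (r * a i + d)) = r * s + d" for r d
    proof -
      have "(\<Sum>i<n. \<mu> (A i) * (r * a i + d)) = r * s + d * (\<Sum>i<n. \<mu> (A i))"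
        by (simp add: s_def sum.distrib sum_distrib_left algebra_simps)
      then show ?thesis by (simp add: ones)
    qed
    have ta: "\<bar>t * f x - t * a i\<bar> \<le> \<bar>t\<bar> * \<epsilon>" if "x \<in> A i" for i x
    proof -
      have "\<bar>t * f x - t * a i\<bar> = \<bar>t\<bar> * \<bar>f x - a i\<bar>"
        by (metis abs_mult right_diff_distrib)
      then show ?thesis using a[OF that] by (simp add: mult_left_mono)
    qed
    have "1 * s + 0 \<le> charge_integral M \<mu> f" "charge_integral M \<mu> f \<le> 1 * s + \<epsilon>"
      unfolding shift[symmetric] using a
      by (auto intro!: le_charge_integral[OF f A] charge_integral_le[OF f A])
    then have "\<bar>charge_integral M \<mu> f - s\<bar> \<le> \<epsilon>" by simp
    then have 1: "\<bar>t * charge_integral M \<mu> f - t * s\<bar> \<le> \<bar>t\<bar> * \<epsilon>"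
      by (metis abs_ge_zero abs_mult mult_left_mono right_diff_distrib)
    have "t * a i + - (\<bar>t\<bar> * \<epsilon>) \<le> t * f x" "t * f x \<le> t * a i + \<bar>t\<bar> * \<epsilon>" if "x \<in> A i" for i x
      using ta[OF that] by linarith+
    then have "t * s + - (\<bar>t\<bar> * \<epsilon>) \<le> charge_integral M \<mu> (\<lambda>x. t * f x)"
      "charge_integral M \<mu> (\<lambda>x. t * f x) \<le> t * s + \<bar>t\<bar> * \<epsilon>"
      unfolding shift[symmetric]
      by (intro le_charge_integral[OF tf A] charge_integral_le[OF tf A]; blast)+
    with 1 show ?thesis by (simp add: abs_le_iff)
  qed
  have "\<bar>charge_integral M \<mu> (\<lambda>x. t * f x) - t * charge_integral M \<mu> f\<bar> \<le> 0 + e" if "e > 0" for e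
  proof -
    have "2 * \<bar>t\<bar> + 1 > 0" by (simp add: add_nonneg_pos)
    then have "e / (2 * \<bar>t\<bar> + 1) > 0" "2 * \<bar>t\<bar> * (e / (2 * \<bar>t\<bar> + 1)) \<le> e"
      using that by (auto simp: field_simps)
    then show ?thesis using close[of "e / (2 * \<bar>t\<bar> + 1)"] by simp
  qed
  then have "\<bar>charge_integral M \<mu> (\<lambda>x. t * f x) - t * charge_integral M \<mu> f\<bar> \<le> 0"
    by (rule field_le_epsilon)
  then show ?thesis by simp
qed

text \<open>
  Summation by parts turns the lower and the upper sum over the slabs into sums over superlevel
  sets, which are the sets that a positive functional controls.
\<close>

lemma layer_cake:
  assumes f: "bounded (range f)" and meas: "\<And>r. {x. r \<le> f x} \<in> M"
    and \<delta>: "0 < \<delta>" and low: "\<And>x. c \<le> f x" and up: "\<And>x. f x < c + real n * \<delta>"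
  shows "c + \<delta> * (\<Sum>i<n. \<mu> (level f c \<delta> (Suc i))) \<le> charge_integral M \<mu> f"
    and "charge_integral M \<mu> f \<le> c + \<delta> * (\<Sum>i<n. \<mu> (level f c \<delta> (Suc i))) + \<delta>"
proof -
  define m where "m = (\<lambda>i. \<mu> (level f c \<delta> i))"
  have A: "finite_partition {..<n} (slab f c \<delta>)"
    by (rule finite_partition_slab[OF meas \<delta> low up])
  have slab: "\<mu> (slab f c \<delta> i) = m i - m (Suc i)" for i
    unfolding slab_def m_def using \<delta> meas
    by (intro Diff_eq) (auto simp: level_def algebra_simps)
  have Abel: "(\<Sum>i<k. (m i - m (Suc i)) * (c + real i * \<delta>)) =
      m 0 * c - m k * (c + real k * \<delta>) + \<delta> * (\<Sum>i<k. m (Suc i))" for k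
    by (induction k) (auto simp: algebra_simps)
  have "level f c \<delta> 0 = UNIV" "level f c \<delta> n = {}"
    using low up by (auto simp: level_def not_le)
  then have m0: "m 0 = 1" and mn: "m n = 0"
    by (simp_all add: m_def total null)
  have sum: "(\<Sum>i<n. \<mu> (slab f c \<delta> i) * (c + real i * \<delta>)) = c + \<delta> * (\<Sum>i<n. m (Suc i))"
    unfolding slab Abel m0 mn by simp
  have "(\<Sum>i<n. \<mu> (slab f c \<delta> i) * (c + real i * \<delta>)) \<le> charge_integral M \<mu> f"
    by (intro le_charge_integral[OF f A]) (rule slab_bounds)
  then show "c + \<delta> * (\<Sum>i<n. \<mu> (level f c \<delta> (Suc i))) \<le> charge_integral M \<mu> f"
    unfolding sum by (simp only: m_def)
  have "(\<Sum>i<n. \<mu> (slab f c \<delta> i)) = 1"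
    using split_along_partition[OF A top] total by simp
  then have "(\<Sum>i<n. \<mu> (slab f c \<delta> i) * (c + real i * \<delta> + \<delta>)) =
      c + \<delta> * (\<Sum>i<n. m (Suc i)) + \<delta>"
    unfolding distrib_left[of _ "c + _"] sum.distrib sum
    by (simp flip: sum_distrib_right)
  moreover have "charge_integral M \<mu> f \<le> (\<Sum>i<n. \<mu> (slab f c \<delta> i) * (c + real i * \<delta> + \<delta>))"
    by (intro charge_integral_le[OF f A]) (rule slab_bounds)
  ultimately show "charge_integral M \<mu> f \<le> c + \<delta> * (\<Sum>i<n. \<mu> (level f c \<delta> (Suc i))) + \<delta>"
    by (simp only: m_def)
qed

end

section \<open>Positive functionals as integrals\<close>

lemma bounded_range_min:
  fixes f :: "'a \<Rightarrow> real"
  assumes "bounded (range f)"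
  shows "bounded (range (\<lambda>x. min (f x) c))"
proof -
  obtain K where K: "\<And>x. \<bar>f x\<bar> \<le> K"
    using assms by (auto simp: bounded_iff)
  have "\<bar>min (f x) c\<bar> \<le> K + \<bar>c\<bar>" for x
    using K[of x] by linarith
  then show ?thesis
    by (intro boundedI[of _ "K + \<bar>c\<bar>"]) auto
qed

locale bounded_function_space = function_space +
  assumes const_mem: "(\<lambda>x. c) \<in> B"
    and min_mem: "f \<in> B \<Longrightarrow> (\<lambda>x. min (f x) c) \<in> B"
    and bounded: "f \<in> B \<Longrightarrow> bounded (range f)"
begin

text \<open>
  The positive normalized elements of the dual.  Positivity and the value at \<open>1\<close>
  bound \<open>\<bar>L f\<bar>\<close> by the supremum norm of \<open>f\<close>.
\<close>

definition normalized_positive :: "(('a \<Rightarrow> real) \<Rightarrow> real) \<Rightarrow> bool" where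
  "normalized_positive L \<longleftrightarrow>
     linear_on L \<and> (\<forall>f\<in>B. (\<forall>x. 0 \<le> f x) \<longrightarrow> 0 \<le> L f) \<and> L (\<lambda>x. 1) = 1"

lemma normalized_positiveD:
  assumes "normalized_positive L"
  shows normalized_positive_add: "f \<in> B \<Longrightarrow> g \<in> B \<Longrightarrow> L (\<lambda>x. f x + g x) = L f + L g"
    and normalized_positive_scale: "f \<in> B \<Longrightarrow> L (\<lambda>x. c * f x) = c * L f"
    and normalized_positive_diff: "f \<in> B \<Longrightarrow> g \<in> B \<Longrightarrow> L (\<lambda>x. f x - g x) = L f - L g"
    and normalized_positive_mono: "f \<in> B \<Longrightarrow> g \<in> B \<Longrightarrow> (\<And>x. f x \<le> g x) \<Longrightarrow> L f \<le> L g"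
    and normalized_positive_const: "L (\<lambda>x. c) = c"
proof -
  show add: "L (\<lambda>x. f x + g x) = L f + L g" if "f \<in> B" "g \<in> B" for f g
    using assms that by (auto simp: normalized_positive_def linear_on_def)
  show scale: "L (\<lambda>x. c * f x) = c * L f" if "f \<in> B" for f c
    using assms that by (auto simp: normalized_positive_def linear_on_def)
  show diff: "L (\<lambda>x. f x - g x) = L f - L g" if "f \<in> B" "g \<in> B" for f g
    using add[OF that(1) uminus_mem[OF that(2)]] scale[OF that(2), of "-1"] by simp
  show "L f \<le> L g" if "f \<in> B" "g \<in> B" "\<And>x. f x \<le> g x" for f g
  proof -
    have "0 \<le> L (\<lambda>x. g x - f x)"
      using assms that diff_mem[OF that(2,1)] by (auto simp: normalized_positive_def)
    then show ?thesis using diff[OF that(2,1)] by simp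
  qed
  show "L (\<lambda>x. c) = c"
    using scale[OF const_mem, of c 1] assms by (simp add: normalized_positive_def)
qed

text \<open>
  A charge represents \<open>L\<close> once it agrees with \<open>L\<close> on superlevel sets in the weak sense that \<open>L g\<close> is
  at least \<open>\<mu> {x. r \<le> f x}\<close> if \<open>g\<close> lies above the indicator of this set, and at most that if \<open>g \<ge> 0\<close> lies
  below the indicator of the strict superlevel set.  The reason is that \<open>f\<close> is, up to a constant, the sum
  of its layers \<open>min f (c + (i + 1) * \<delta>) - min f (c + i * \<delta>)\<close>, each of which is \<open>\<delta>\<close> times a function between
  two such indicators.  So \<open>L f\<close> satisfies the same bounds as the integral, up to \<open>\<delta>\<close>.
\<close>

theorem charge_integral_eqI:
  assumes "prob_charge M \<mu>" and L: "normalized_positive L" and f: "f \<in> B"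
    and meas: "\<And>r. {x. r \<le> f x} \<in> M"
    and lower: "\<And>r g. g \<in> B \<Longrightarrow> (\<And>x. indicator {x. r \<le> f x} x \<le> g x) \<Longrightarrow> \<mu> {x. r \<le> f x} \<le> L g"
    and upper: "\<And>r g. g \<in> B \<Longrightarrow> (\<And>x. 0 \<le> g x) \<Longrightarrow> (\<And>x. g x \<le> indicator {x. r < f x} x) \<Longrightarrow>
      L g \<le> \<mu> {x. r \<le> f x}"
  shows "L f = charge_integral M \<mu> f"
proof -
  interpret \<mu>: prob_charge M \<mu> by fact
  have "\<bar>L f - charge_integral M \<mu> f\<bar> \<le> 0 + \<epsilon>" if "\<epsilon> > 0" for \<epsilon>
  proof -
    obtain c \<delta> n where g: "0 < \<delta>" "\<delta> \<le> \<epsilon>" "\<And>x. c \<le> f x" "\<And>x. f x < c + real n * \<delta>"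
      using \<mu>.bounded_grid[OF bounded[OF f] \<open>\<epsilon> > 0\<close>] by metis
    define S where "S = (\<Sum>i<n. \<mu> (\<mu>.level f c \<delta> (Suc i)))"
    define T where "T = (\<Sum>i<n. \<mu> (\<mu>.level f c \<delta> i))"
    \<comment> \<open>\<open>cut i\<close> is \<open>c\<close> plus the sum of the first \<open>i\<close> layers; \<open>h\<close> below is a layer divided by its height.\<close>
    define cut where "cut = (\<lambda>i x. min (f x) (c + real i * \<delta>))"
    have cut: "cut i \<in> B" for i
      unfolding cut_def by (rule min_mem[OF f])
    have step: "\<delta> * \<mu> (\<mu>.level f c \<delta> (Suc i)) \<le> L (cut (Suc i)) - L (cut i)"
      "L (cut (Suc i)) - L (cut i) \<le> \<delta> * \<mu> (\<mu>.level f c \<delta> i)" for i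
    proof -
      define h where "h = (\<lambda>x. (1 / \<delta>) * (cut (Suc i) x - cut i x))"
      have h: "h \<in> B"
        unfolding h_def by (intro scale_mem diff_mem cut)
      have Lh: "L (cut (Suc i)) - L (cut i) = \<delta> * L h"
        unfolding h_def using g(1)
        by (simp only: normalized_positive_scale[OF L diff_mem[OF cut cut]]
            normalized_positive_diff[OF L cut cut]) simp
      have cut_le: "cut i x \<le> cut (Suc i) x" "cut (Suc i) x \<le> cut i x + \<delta>" for x
        using g(1) by (auto simp: cut_def algebra_simps)
      have "indicator {x. c + real (Suc i) * \<delta> \<le> f x} x \<le> h x" for x
      proof (cases "c + real (Suc i) * \<delta> \<le> f x")
        case True
        then have "cut (Suc i) x - cut i x = \<delta>"
          using g(1) by (simp add: cut_def algebra_simps)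
        then show ?thesis using g(1) by (simp add: h_def indicator_def)
      qed (use g(1) cut_le[of x] in \<open>simp add: h_def\<close>)
      then have "\<mu> (\<mu>.level f c \<delta> (Suc i)) \<le> L h"
        unfolding \<mu>.level_def by (intro lower h)
      then show "\<delta> * \<mu> (\<mu>.level f c \<delta> (Suc i)) \<le> L (cut (Suc i)) - L (cut i)"
        unfolding Lh using g(1) by simp
      have "h x \<le> indicator {x. c + real i * \<delta> < f x} x" for x
      proof (cases "c + real i * \<delta> < f x")
        case True
        then show ?thesis using g(1) cut_le(2)[of x] by (simp add: h_def field_simps)
      next
        case False
        then have "f x \<le> c + real (Suc i) * \<delta>"
          using g(1) by (simp add: algebra_simps)
        with False show ?thesis by (simp add: h_def cut_def)
      qed
      moreover have "0 \<le> h x" for x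
        using g(1) cut_le(1)[of x] by (simp add: h_def)
      ultimately have "L h \<le> \<mu> (\<mu>.level f c \<delta> i)"
        unfolding \<mu>.level_def by (intro upper h)
      then show "L (cut (Suc i)) - L (cut i) \<le> \<delta> * \<mu> (\<mu>.level f c \<delta> i)"
        unfolding Lh using g(1) by simp
    qed
    have "cut 0 = (\<lambda>x. c)" "cut n = f"
      using g(3) less_imp_le[OF g(4)] by (simp_all add: cut_def min_absorb1 min_absorb2)
    then have "(\<Sum>i<n. L (cut (Suc i)) - L (cut i)) = L f - c"
      using sum_lessThan_telescope[of "\<lambda>i. L (cut i)" n]
      by (simp add: normalized_positive_const[OF L])
    then have "\<delta> * S \<le> L f - c" "L f - c \<le> \<delta> * T"
      unfolding S_def T_def sum_distrib_left using step by (metis (no_types, lifting) sum_mono)+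
    moreover have "T \<le> S + 1"
    proof -
      have "T - S = \<mu> (\<mu>.level f c \<delta> 0) - \<mu> (\<mu>.level f c \<delta> n)"
        unfolding T_def S_def sum_subtractf[symmetric] by (rule sum_lessThan_telescope')
      moreover have "\<mu>.level f c \<delta> 0 = UNIV" "\<mu>.level f c \<delta> n = {}"
        using g(3,4) by (auto simp: \<mu>.level_def not_le)
      ultimately show ?thesis by (simp add: \<mu>.total \<mu>.null)
    qed
    then have "\<delta> * T \<le> \<delta> * S + \<delta>"
      using g(1) mult_left_mono[of T "S + 1" \<delta>] by (simp add: algebra_simps)
    moreover have "c + \<delta> * S \<le> charge_integral M \<mu> f" "charge_integral M \<mu> f \<le> c + \<delta> * S + \<delta>"
      unfolding S_def by (intro \<mu>.layer_cake[OF bounded[OF f] meas g(1,3,4)])+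
    ultimately show ?thesis using g(2) by (simp add: abs_le_iff)
  qed
  then have "\<bar>L f - charge_integral M \<mu> f\<bar> \<le> 0"
    by (rule field_le_epsilon)
  then show ?thesis by simp
qed

end

section \<open>Directional derivatives of pressure functions\<close>

locale pressure = bounded_function_space +
  fixes \<Gamma> and \<phi>
  assumes pressure: "pressure_function B \<Gamma>"
    and \<phi>: "\<phi> \<in> B"
begin

lemma pressure_mono: "f \<in> B \<Longrightarrow> g \<in> B \<Longrightarrow> (\<And>x. f x \<le> g x) \<Longrightarrow> \<Gamma> f \<le> \<Gamma> g"
  and pressure_const: "f \<in> B \<Longrightarrow> \<Gamma> (\<lambda>x. f x + c) = \<Gamma> f + c"
  and pressure_convex: "f \<in> B \<Longrightarrow> g \<in> B \<Longrightarrow> 0 \<le> t \<Longrightarrow> t \<le> 1 \<Longrightarrow>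
    \<Gamma> (\<lambda>x. t * f x + (1 - t) * g x) \<le> t * \<Gamma> f + (1 - t) * \<Gamma> g"
  using pressure by (simp_all add: pressure_function_def)

definition quot :: "('a \<Rightarrow> real) \<Rightarrow> real \<Rightarrow> real" where
  "quot \<psi> t = (1 / t) * (\<Gamma> (\<lambda>x. \<phi> x + t * \<psi> x) - \<Gamma> \<phi>)"

definition right_deriv :: "('a \<Rightarrow> real) \<Rightarrow> real" where
  "right_deriv \<psi> = (INF t\<in>{0<..}. quot \<psi> t)"

lemma perturbed_mem: "\<psi> \<in> B \<Longrightarrow> (\<lambda>x. \<phi> x + t * \<psi> x) \<in> B"
  by (intro add_mem \<phi> scale_mem)

text \<open>
  Convexity on the segment from \<open>\<phi>\<close> to \<open>\<phi> + t * \<psi>\<close>.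
\<close>

lemma quot_mono:
  assumes \<psi>: "\<psi> \<in> B" and st: "0 < s" "s \<le> t"
  shows "quot \<psi> s \<le> quot \<psi> t"
proof -
  have eq: "(\<lambda>x. s / t * (\<phi> x + t * \<psi> x) + (1 - s / t) * \<phi> x) = (\<lambda>x. \<phi> x + s * \<psi> x)"
    using st by (simp add: fun_eq_iff field_simps)
  have "\<Gamma> (\<lambda>x. \<phi> x + s * \<psi> x) \<le> s / t * \<Gamma> (\<lambda>x. \<phi> x + t * \<psi> x) + (1 - s / t) * \<Gamma> \<phi>"
    using pressure_convex[OF perturbed_mem[OF \<psi>, of t] \<phi>, of "s / t"] st unfolding eq by simp
  then have "\<Gamma> (\<lambda>x. \<phi> x + s * \<psi> x) - \<Gamma> \<phi> \<le> s * quot \<psi> t"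
    by (simp add: quot_def algebra_simps)
  then show ?thesis
    using st by (simp add: quot_def[of \<psi> s] pos_divide_le_eq mult.commute)
qed

text \<open>
  Monotonicity and translation invariance make \<open>\<Gamma>\<close> decrease by at most \<open>t * K\<close>; this is what keeps the
  one-sided derivative finite.
\<close>

lemma quot_lower:
  assumes \<psi>: "\<psi> \<in> B" and K: "\<And>x. - K \<le> \<psi> x" and t: "0 < t"
  shows "- K \<le> quot \<psi> t"
proof -
  have "\<Gamma> \<phi> + - (t * K) = \<Gamma> (\<lambda>x. \<phi> x + - (t * K))"
    by (rule pressure_const[OF \<phi>, symmetric])
  also have "\<dots> \<le> \<Gamma> (\<lambda>x. \<phi> x + t * \<psi> x)"
  proof (rule pressure_mono)
    fix x
    have "t * - K \<le> t * \<psi> x"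
      using K t by (intro mult_left_mono) auto
    then show "\<phi> x + - (t * K) \<le> \<phi> x + t * \<psi> x" by simp
  qed (intro add_mem \<phi> const_mem perturbed_mem \<psi>)+
  finally show ?thesis
    using t by (simp add: quot_def pos_le_divide_eq mult.commute)
qed

lemma quot_bdd_below:
  assumes "\<psi> \<in> B"
  shows "\<exists>m. \<forall>t>0. m \<le> quot \<psi> t"
proof -
  obtain K where K: "\<And>x. \<bar>\<psi> x\<bar> \<le> K"
    using bounded[OF assms] by (auto simp: bounded_iff)
  have "- K \<le> \<psi> x" for x
    using K[of x] by linarith
  then show ?thesis
    using quot_lower[OF assms, of K] by blast
qed

lemma right_deriv_le_quot: "\<psi> \<in> B \<Longrightarrow> 0 < t \<Longrightarrow> right_deriv \<psi> \<le> quot \<psi> t"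
  unfolding right_deriv_def using quot_bdd_below[of \<psi>]
  by (intro cINF_lower) (auto intro: bdd_belowI2)

lemma le_right_deriv: "(\<And>t. 0 < t \<Longrightarrow> c \<le> quot \<psi> t) \<Longrightarrow> c \<le> right_deriv \<psi>"
  unfolding right_deriv_def by (intro cINF_greatest) auto

lemma right_deriv_le: "\<psi> \<in> B \<Longrightarrow> right_deriv \<psi> \<le> \<Gamma> (\<lambda>x. \<phi> x + \<psi> x) - \<Gamma> \<phi>"
  using right_deriv_le_quot[of \<psi> 1] by (simp add: quot_def)

lemma quot_tendsto_right: 
  assumes "\<psi> \<in> B"
  shows "(quot \<psi> \<longlongrightarrow> right_deriv \<psi>) (at_right 0)"
proof -
  obtain m where "\<And>t. 0 < t \<Longrightarrow> m \<le> quot \<psi> t"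
    using quot_bdd_below[OF assms] by auto
  then have "(quot \<psi> \<longlongrightarrow> Inf (quot \<psi> ` ({0<..} \<inter> UNIV))) (at 0 within ({0<..} \<inter> UNIV))"
    using quot_mono[OF assms] by (intro Lim_right_bound) auto
  then show ?thesis by (simp add: right_deriv_def)
qed

lemma quot_tendsto_left:
  assumes "\<psi> \<in> B"
  shows "(quot \<psi> \<longlongrightarrow> - right_deriv (\<lambda>x. - \<psi> x)) (at_left 0)"
proof -
  have "quot \<psi> (- t) = - quot (\<lambda>x. - \<psi> x) t" for t
    by (simp add: quot_def)
  then show ?thesis
    using tendsto_minus[OF quot_tendsto_right[OF uminus_mem[OF assms]]]
    by (simp add: filterlim_at_left_to_right)
qed

text \<open>
  Both one-sided derivatives always exist, and the left one is \<open>- right_deriv (- \<psi>)\<close>.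
\<close>

lemma gateaux_iff_right_deriv_odd:
  "gateaux_differentiable_at B \<Gamma> \<phi> \<longleftrightarrow> (\<forall>\<psi>\<in>B. right_deriv (\<lambda>x. - \<psi> x) = - right_deriv \<psi>)"
proof -
  have "(\<exists>l. (quot \<psi> \<longlongrightarrow> l) (at 0)) \<longleftrightarrow> right_deriv (\<lambda>x. - \<psi> x) = - right_deriv \<psi>"
    if \<psi>: "\<psi> \<in> B" for \<psi>
  proof
    assume "\<exists>l. (quot \<psi> \<longlongrightarrow> l) (at 0)"
    then obtain l where "(quot \<psi> \<longlongrightarrow> l) (at_left 0)" "(quot \<psi> \<longlongrightarrow> l) (at_right 0)"
      by (auto simp: filterlim_at_split)
    then have "l = - right_deriv (\<lambda>x. - \<psi> x)" "l = right_deriv \<psi>"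
      using quot_tendsto_left[OF \<psi>] quot_tendsto_right[OF \<psi>]
      by (auto intro: tendsto_unique[OF trivial_limit_at_left_real] tendsto_unique[OF trivial_limit_at_right_real])
    then show "right_deriv (\<lambda>x. - \<psi> x) = - right_deriv \<psi>" by simp
  next
    assume "right_deriv (\<lambda>x. - \<psi> x) = - right_deriv \<psi>"
    then show "\<exists>l. (quot \<psi> \<longlongrightarrow> l) (at 0)"
      using quot_tendsto_left[OF \<psi>] quot_tendsto_right[OF \<psi>]
      by (auto simp: filterlim_at_split)
  qed
  then show ?thesis
    by (simp add: gateaux_differentiable_at_def quot_def[abs_def])
qed

text \<open>
  Midpoint convexity: \<open>\<phi> + (r / 2) * (f + g)\<close> is halfway between \<open>\<phi> + r * f\<close> and \<open>\<phi> + r * g\<close>.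
\<close>

lemma quot_add_le:
  assumes f: "f \<in> B" and g: "g \<in> B" and r: "0 < r"
  shows "quot (\<lambda>x. f x + g x) (r / 2) \<le> quot f r + quot g r"
proof -
  have eq: "(\<lambda>x. 1/2 * (\<phi> x + r * f x) + (1 - 1/2) * (\<phi> x + r * g x)) = (\<lambda>x. \<phi> x + r / 2 * (f x + g x))"
    by (simp add: fun_eq_iff field_simps)
  have "\<Gamma> (\<lambda>x. \<phi> x + r / 2 * (f x + g x)) \<le>
      1/2 * \<Gamma> (\<lambda>x. \<phi> x + r * f x) + (1 - 1/2) * \<Gamma> (\<lambda>x. \<phi> x + r * g x)"
    using pressure_convex[OF perturbed_mem[OF f] perturbed_mem[OF g], of "1/2" r r] unfolding eq by simp
  then have "1 / r * (2 * (\<Gamma> (\<lambda>x. \<phi> x + r / 2 * (f x + g x)) - \<Gamma> \<phi>)) \<le>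
      1 / r * ((\<Gamma> (\<lambda>x. \<phi> x + r * f x) - \<Gamma> \<phi>) + (\<Gamma> (\<lambda>x. \<phi> x + r * g x) - \<Gamma> \<phi>))"
    using r by (intro mult_left_mono) auto
  then show ?thesis
    by (simp add: quot_def distrib_left add_divide_distrib diff_divide_distrib)
qed

lemma sublinear_right_deriv: "sublinear_on right_deriv"
  unfolding sublinear_on_def
proof (intro conjI ballI allI impI)
  fix f g assume f: "f \<in> B" and g: "g \<in> B"
  have "right_deriv (\<lambda>x. f x + g x) \<le> quot f s + quot g t" if "0 < s" "0 < t" for s t
  proof -
    have "right_deriv (\<lambda>x. f x + g x) \<le> quot (\<lambda>x. f x + g x) (min s t / 2)"
      using that by (intro right_deriv_le_quot add_mem f g) auto
    also have "\<dots> \<le> quot f (min s t) + quot g (min s t)"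
      using that by (intro quot_add_le f g) auto
    also have "\<dots> \<le> quot f s + quot g t"
      using that by (intro add_mono quot_mono f g) auto
    finally show ?thesis .
  qed
  then have "right_deriv (\<lambda>x. f x + g x) - quot g t \<le> right_deriv f" if "0 < t" for t
    using that by (intro le_right_deriv) (simp add: algebra_simps)
  then have "right_deriv (\<lambda>x. f x + g x) - right_deriv f \<le> right_deriv g"
    by (intro le_right_deriv) (simp add: algebra_simps)
  then show "right_deriv (\<lambda>x. f x + g x) \<le> right_deriv f + right_deriv g" by simp
next
  fix f and c :: real assume f: "f \<in> B" and c: "c > 0"
  have "right_deriv (\<lambda>x. c * f x) / c \<le> right_deriv f"
  proof (rule le_right_deriv)
    fix t :: real assume t: "0 < t"
    have "right_deriv (\<lambda>x. c * f x) \<le> quot (\<lambda>x. c * f x) (t / c)"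
      using t c by (intro right_deriv_le_quot scale_mem f) auto
    also have "\<dots> = c * quot f t"
      using c t by (simp add: quot_def)
    finally show "right_deriv (\<lambda>x. c * f x) / c \<le> quot f t"
      using c by (simp add: pos_divide_le_eq mult.commute)
  qed
  then show "right_deriv (\<lambda>x. c * f x) \<le> c * right_deriv f"
    using c by (simp add: pos_divide_le_eq mult.commute)
qed

text \<open>
  Monotonicity of \<open>\<Gamma>\<close>, applied to \<open>\<phi> - f \<le> \<phi>\<close>, gives positivity, and translation invariance, applied
  to the constants \<open>1\<close> and \<open>-1\<close>, gives normalization.
\<close>

lemma normalized_positive_if_dominated:
  assumes lin: "linear_on L" and le: "\<And>\<psi>. \<psi> \<in> B \<Longrightarrow> L \<psi> \<le> right_deriv \<psi>"
  shows "normalized_positive L"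
proof -
  have tangent: "L \<psi> \<le> \<Gamma> (\<lambda>x. \<phi> x + \<psi> x) - \<Gamma> \<phi>" if "\<psi> \<in> B" for \<psi>
    using le[OF that] right_deriv_le[OF that] by simp
  have minus: "L (\<lambda>x. - \<psi> x) = - L \<psi>" if "\<psi> \<in> B" for \<psi>
    using lin that unfolding linear_on_def by (metis (no_types, lifting) ext mult_minus1)
  have "0 \<le> L f" if f: "f \<in> B" "\<And>x. 0 \<le> f x" for f
  proof -
    have "\<Gamma> (\<lambda>x. \<phi> x + - f x) \<le> \<Gamma> \<phi>"
      using f(2) by (intro pressure_mono add_mem uminus_mem \<phi> f(1)) auto
    then show ?thesis
      using tangent[OF uminus_mem[OF f(1)]] minus[OF f(1)] by simp
  qed
  moreover have "L (\<lambda>x. 1) = 1"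
    using tangent[OF const_mem, of 1] tangent[OF const_mem, of "-1"] minus[OF const_mem, of 1]
      pressure_const[OF \<phi>, of 1] pressure_const[OF \<phi>, of "-1"] by simp
  ultimately show ?thesis
    using lin by (simp add: normalized_positive_def)
qed

text \<open>
  The tangent inequality in the direction \<open>t * \<psi>\<close>, divided by \<open>t\<close>, says \<open>J \<psi> \<le> quot \<psi> t\<close>.
\<close>

lemma le_right_deriv_if_tangent:
  assumes \<psi>: "\<psi> \<in> B" and hom: "\<And>t. J (\<lambda>x. t * \<psi> x) = t * J \<psi>"
    and le: "\<And>f. f \<in> B \<Longrightarrow> J f \<le> \<Gamma> (\<lambda>x. \<phi> x + f x) - \<Gamma> \<phi>"
  shows "J \<psi> \<le> right_deriv \<psi>"
proof (rule le_right_deriv)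
  fix t :: real assume "0 < t"
  moreover have "t * J \<psi> \<le> \<Gamma> (\<lambda>x. \<phi> x + t * \<psi> x) - \<Gamma> \<phi>"
    using le[OF scale_mem[OF \<psi>, of t]] unfolding hom .
  ultimately show "J \<psi> \<le> quot \<psi> t"
    by (simp add: quot_def pos_le_divide_eq mult.commute)
qed

text \<open>
  Here \<open>P\<close> is a set of objects that represent the normalized positive functionals faithfully through \<open>J\<close>.
  Every tangent is at most the right derivative.  If the right derivative is odd, this forces equality,
  so the tangent is unique.  Conversely, for each \<open>\<psi>\<close> there are tangents that touch the right derivative at
  \<open>\<psi>\<close> and at \<open>- \<psi>\<close>; if there is only one tangent, these two coincide, so the right derivative is odd.
\<close>

theorem gateaux_iff_unique_tangent:
  fixes P :: "'m set" and J :: "'m \<Rightarrow> ('a \<Rightarrow> real) \<Rightarrow> real"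
  assumes hom: "\<And>\<mu> \<psi> t. \<mu> \<in> P \<Longrightarrow> \<psi> \<in> B \<Longrightarrow> J \<mu> (\<lambda>x. t * \<psi> x) = t * J \<mu> \<psi>"
    and rep: "\<And>L. normalized_positive L \<Longrightarrow> \<exists>\<mu>\<in>P. \<forall>f\<in>B. L f = J \<mu> f"
    and inj: "\<And>\<mu> \<nu>. \<mu> \<in> P \<Longrightarrow> \<nu> \<in> P \<Longrightarrow> (\<And>f. f \<in> B \<Longrightarrow> J \<mu> f = J \<nu> f) \<Longrightarrow> \<mu> = \<nu>"
  shows "gateaux_differentiable_at B \<Gamma> \<phi> \<longleftrightarrow>
    (\<exists>!\<mu>. \<mu> \<in> {\<mu>\<in>P. \<forall>\<psi>\<in>B. \<Gamma> (\<lambda>x. \<phi> x + \<psi> x) - \<Gamma> \<phi> \<ge> J \<mu> \<psi>})"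
    (is "_ \<longleftrightarrow> (\<exists>!\<mu>. \<mu> \<in> ?T)")
proof
  have touching: "\<exists>\<mu>\<in>?T. J \<mu> h = right_deriv h" if h: "h \<in> B" for h
  proof -
    obtain L where L: "linear_on L" "\<And>f. f \<in> B \<Longrightarrow> L f \<le> right_deriv f" "L h = right_deriv h"
      by (rule Hahn_Banach_touching[OF sublinear_right_deriv h]) (rule that)
    obtain \<mu> where \<mu>: "\<mu> \<in> P" "\<forall>f\<in>B. L f = J \<mu> f"
      using rep[OF normalized_positive_if_dominated[OF L(1,2)]] by auto
    have "J \<mu> f \<le> \<Gamma> (\<lambda>x. \<phi> x + f x) - \<Gamma> \<phi>" if "f \<in> B" for f
      using L(2)[OF that] right_deriv_le[OF that] \<mu>(2) that by fastforce
    then show ?thesis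
      using \<mu> L(3) h by (intro bexI[of _ \<mu>]) auto
  qed
  have below: "J \<mu> \<psi> \<le> right_deriv \<psi>" if "\<mu> \<in> ?T" "\<psi> \<in> B" for \<mu> \<psi>
    using that by (intro le_right_deriv_if_tangent hom) auto
  {
    assume "gateaux_differentiable_at B \<Gamma> \<phi>"
    then have odd: "right_deriv (\<lambda>x. - \<psi> x) = - right_deriv \<psi>" if "\<psi> \<in> B" for \<psi>
      using that by (simp add: gateaux_iff_right_deriv_odd)
    have eq: "J \<mu> \<psi> = right_deriv \<psi>" if \<mu>: "\<mu> \<in> ?T" and \<psi>: "\<psi> \<in> B" for \<mu> \<psi>
    proof (rule antisym[OF below[OF that]])
      have "J \<mu> (\<lambda>x. - \<psi> x) = - J \<mu> \<psi>"
        using hom[of \<mu> \<psi> "-1"] \<mu> \<psi> by simp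
      then show "right_deriv \<psi> \<le> J \<mu> \<psi>"
        using below[OF \<mu> uminus_mem[OF \<psi>]] odd[OF \<psi>] by simp
    qed
    have "\<mu> = \<nu>" if \<mu>: "\<mu> \<in> ?T" and \<nu>: "\<nu> \<in> ?T" for \<mu> \<nu>
      using \<mu> \<nu> by (intro inj) (auto simp: eq[OF \<mu>] eq[OF \<nu>])
    moreover obtain \<mu> where "\<mu> \<in> ?T"
      using touching[OF zero_mem] by blast
    ultimately show "\<exists>!\<mu>. \<mu> \<in> ?T" by blast
  }
  assume unique: "\<exists>!\<mu>. \<mu> \<in> ?T"
  show "gateaux_differentiable_at B \<Gamma> \<phi>"
    unfolding gateaux_iff_right_deriv_odd
  proof
    fix \<psi> assume \<psi>: "\<psi> \<in> B"
    obtain \<mu> where \<mu>: "\<mu> \<in> ?T" "J \<mu> \<psi> = right_deriv \<psi>"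
      using touching[OF \<psi>] by blast
    obtain \<nu> where \<nu>: "\<nu> \<in> ?T" "J \<nu> (\<lambda>x. - \<psi> x) = right_deriv (\<lambda>x. - \<psi> x)"
      using touching[OF uminus_mem[OF \<psi>]] by blast
    have "\<mu> = \<nu>" using unique \<mu>(1) \<nu>(1) by blast
    then show "right_deriv (\<lambda>x. - \<psi> x) = - right_deriv \<psi>"
      using hom[of \<mu> \<psi> "-1"] \<mu> \<nu> \<psi> by simp
  qed
qed

end

section \<open>Regular charges from functionals on bounded continuous functions\<close>

lemma bcontfun_unitI:
  fixes f :: "'a::topological_space \<Rightarrow> real"
  assumes "continuous_on UNIV f" "\<And>x. 0 \<le> f x" "\<And>x. f x \<le> 1"
  shows "f \<in> bcontfun"
proof -
  have "bounded (range f)"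
    using assms(2,3) by (intro boundedI[of _ 1]) auto
  with assms(1) show ?thesis by (simp add: bcontfun_def)
qed

lemma bounded_function_space_bcontfun:
  "bounded_function_space (bcontfun :: ('a::topological_space \<Rightarrow> real) set)"
proof
  fix f g :: "'a \<Rightarrow> real" and c
  assume f: "f \<in> bcontfun"
  then have cont: "continuous_on UNIV f" and bdd: "bounded (range f)"
    by (auto simp: bcontfun_def)
  show "(\<lambda>x. c * f x) \<in> bcontfun"
    using cont bounded_scaling[OF bdd, of c]
    by (auto simp: bcontfun_def image_image intro!: continuous_intros)
  show "(\<lambda>x. min (f x) c) \<in> bcontfun"
    using cont bounded_range_min[OF bdd] by (auto simp: bcontfun_def intro!: continuous_intros)
  show "bounded (range f)" by fact
qed (auto intro: plus_cont const_bcontfun)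

lemma cozero_function:
  fixes U :: "'a::metric_space set"
  assumes "open U"
  obtains u :: "'a \<Rightarrow> real" where "continuous_on UNIV u" "\<And>x. 0 \<le> u x" "\<And>x. 0 < u x \<longleftrightarrow> x \<in> U"
proof (cases "U = UNIV")
  case True
  then show ?thesis by (intro that[of "\<lambda>_. 1"]) auto
next
  case False
  then have "infdist x (- U) = 0 \<longleftrightarrow> x \<notin> U" for x
    using in_closed_iff_infdist_zero[of "- U" x] assms by auto
  then have "0 < infdist x (- U) \<longleftrightarrow> x \<in> U" for x
    using infdist_nonneg[of x "- U"] by (metis less_le)
  then show ?thesis
    by (intro that[of "\<lambda>x. infdist x (- U)"] infdist_nonneg) (auto intro!: continuous_intros)
qed

text \<open>
  The quotient \<open>u / (u + v)\<close>, with \<open>u\<close> positive exactly on \<open>G\<close> and \<open>v\<close> positive exactly off \<open>F\<close>.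
\<close>

lemma Urysohn_bcontfun:
  fixes F G :: "'a::metric_space set"
  assumes "closed F" "open G" "F \<subseteq> G"
  obtains f where "f \<in> bcontfun" "\<And>x. indicator F x \<le> f x" "\<And>x. f x \<le> (indicator G x :: real)"
proof -
  obtain u where u: "continuous_on UNIV u" "\<And>x. 0 \<le> u x" "\<And>x. (0::real) < u x \<longleftrightarrow> x \<in> G"
    using cozero_function[OF assms(2)] by metis
  obtain v where v: "continuous_on UNIV v" "\<And>x. 0 \<le> v x" "\<And>x. (0::real) < v x \<longleftrightarrow> x \<in> - F"
    using cozero_function[of "- F"] assms(1) by (metis open_Compl)
  have pos: "0 < u x + v x" for x
    using u(2,3)[of x] v(2,3)[of x] assms(3) by (cases "x \<in> F") (auto intro: add_pos_nonneg add_nonneg_pos)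
  have u0: "u x = 0" if "x \<notin> G" for x using u(2,3)[of x] that by simp
  have v0: "v x = 0" if "x \<in> F" for x using v(2,3)[of x] that by simp
  define f where "f = (\<lambda>x. u x / (u x + v x))"
  have le1: "f x \<le> 1" for x
    using pos[of x] v(2)[of x] by (simp add: f_def)
  have nonneg: "0 \<le> f x" for x
    using pos[of x] u(2)[of x] by (simp add: f_def)
  have "continuous_on UNIV f"
    unfolding f_def using u(1) v(1) pos by (intro continuous_intros) (auto simp: less_imp_neq[symmetric])
  then have "f \<in> bcontfun"
    using nonneg le1 by (intro bcontfun_unitI)
  moreover have "indicator F x \<le> f x" for x
    using nonneg[of x] v0[of x] pos[of x] by (auto simp: indicator_def f_def)
  moreover have "f x \<le> indicator G x" for x
    using le1[of x] u0[of x] by (auto simp: indicator_def f_def)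
  ultimately show ?thesis by (rule that)
qed

locale bcontfun_functional =
  fixes L :: "('a::metric_space \<Rightarrow> real) \<Rightarrow> real"
  assumes normalized_positive: "bounded_function_space.normalized_positive bcontfun L"
begin

sublocale bounded_function_space "bcontfun :: ('a \<Rightarrow> real) set"
  by (rule bounded_function_space_bcontfun)

lemmas L = normalized_positive_add[OF normalized_positive] normalized_positive_scale[OF normalized_positive]
  normalized_positive_const[OF normalized_positive]

lemmas L_mono = normalized_positive_mono[OF normalized_positive]

definition test :: "'a set \<Rightarrow> ('a \<Rightarrow> real) set" where
  "test U = {f \<in> bcontfun. \<forall>x. 0 \<le> f x \<and> f x \<le> indicator U x}"

text \<open>
  The content and the outer set function of the classical construction in the Riesz representation
  theorem.  The functions tested are only required to vanish off \<open>U\<close>, not to have support inside \<open>U\<close>, so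
  the arguments below cut them off at a small height instead.
\<close>

definition content :: "'a set \<Rightarrow> real" where
  "content U = (SUP f\<in>test U. L f)"

definition outer :: "'a set \<Rightarrow> real" where
  "outer A = (INF U\<in>{U. open U \<and> A \<subseteq> U}. content U)"

lemma testD:
  assumes "f \<in> test U"
  shows "f \<in> bcontfun" "continuous_on UNIV f" "0 \<le> f x" "f x \<le> 1" "x \<notin> U \<Longrightarrow> f x = 0"
proof -
  have *: "0 \<le> f x" "f x \<le> indicator U x" for x
    using assms by (auto simp: test_def)
  show "f \<in> bcontfun" "continuous_on UNIV f"
    using assms by (auto simp: test_def bcontfun_def)
  show "0 \<le> f x" "f x \<le> 1" "x \<notin> U \<Longrightarrow> f x = 0"
    using *[of x] by (cases "x \<in> U"; simp)+
qed

lemma testI: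
  assumes "continuous_on UNIV f" "\<And>x. 0 \<le> f x" "\<And>x. f x \<le> 1" "\<And>x. x \<notin> U \<Longrightarrow> f x = 0"
  shows "f \<in> test U"
  using assms bcontfun_unitI[OF assms(1-3)] by (auto simp: test_def indicator_def)

lemma zero_test: "(\<lambda>x. 0) \<in> test U"
  by (intro testI) auto

lemma test_le_content: "f \<in> test U \<Longrightarrow> L f \<le> content U"
  unfolding content_def
proof (rule cSUP_upper)
  have "L f \<le> L (\<lambda>x. 1)" if "f \<in> test U" for f
    using testD[OF that] by (intro L_mono const_mem)
  then show "bdd_above (L ` test U)"
    by (intro bdd_aboveI2[of _ _ 1]) (simp add: L)
qed

lemma content_le: "(\<And>f. f \<in> test U \<Longrightarrow> L f \<le> c) \<Longrightarrow> content U \<le> c"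
  unfolding content_def using zero_test by (intro cSUP_least) auto

lemma content_nonneg: "0 \<le> content U"
  using test_le_content[OF zero_test, of U] by (simp add: L)

lemma content_mono: "U \<subseteq> V \<Longrightarrow> content U \<le> content V"
proof (intro content_le test_le_content)
  fix f assume "U \<subseteq> V" "f \<in> test U"
  then show "f \<in> test V"
    using testD[of f U] by (intro testI) auto
qed

lemma content_empty: "content {} = 0"
proof (rule antisym[OF content_le content_nonneg])
  fix f assume "f \<in> test {}"
  then have "f = (\<lambda>x. 0)" using testD(5) by fastforce
  then show "L f \<le> 0" by (simp add: L)
qed

lemma content_UNIV: "content UNIV = 1"
proof (rule antisym)
  show "content UNIV \<le> 1"
  proof (rule content_le)
    fix f :: "'a \<Rightarrow> real" assume "f \<in> test UNIV"
    then have "L f \<le> L (\<lambda>x. 1)"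
      using testD by (intro L_mono const_mem)
    then show "L f \<le> 1" by (simp add: L)
  qed
  show "1 \<le> content UNIV"
    using test_le_content[of "\<lambda>x. 1" UNIV] testI[of "\<lambda>x. 1" UNIV] by (simp add: L)
qed

text \<open>
  The cut-off function is nonzero only where \<open>\<epsilon> < f x\<close>, and \<open>{x. \<epsilon> \<le> f x}\<close> is a closed subset of \<open>U\<close>; it
  takes the place of the compact support.
\<close>

lemma truncate_test:
  assumes f: "f \<in> test U" and \<epsilon>: "\<epsilon> > 0"
  shows "(\<lambda>x. max (f x - \<epsilon>) 0) \<in> test U" "L f \<le> L (\<lambda>x. max (f x - \<epsilon>) 0) + \<epsilon>"
proof -
  show g: "(\<lambda>x. max (f x - \<epsilon>) 0) \<in> test U"
    using testD(2,4,5)[OF f] \<epsilon>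
    by (intro testI) (auto intro!: continuous_intros simp: algebra_simps add_increasing2)
  have "L f \<le> L (\<lambda>x. max (f x - \<epsilon>) 0 + \<epsilon>)"
    by (intro L_mono add_mem const_mem testD[OF f] testD[OF g]) auto
  then show "L f \<le> L (\<lambda>x. max (f x - \<epsilon>) 0) + \<epsilon>"
    by (simp add: L testD[OF g] const_mem)
qed

text \<open>
  A partition of unity on the set where \<open>\<epsilon> < f x\<close>.
\<close>

lemma test_split:
  assumes f: "f \<in> test (U \<union> V)" and UV: "open U" "open V" and \<epsilon>: "\<epsilon> > 0"
  obtains g h where "g \<in> test U" "h \<in> test V" "\<And>x. max (f x - \<epsilon>) 0 = g x + h x"
proof -
  obtain u where u: "continuous_on UNIV u" "\<And>x. 0 \<le> u x" "\<And>x. (0::real) < u x \<longleftrightarrow> x \<in> U"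
    using cozero_function[OF UV(1)] by metis
  obtain v where v: "continuous_on UNIV v" "\<And>x. 0 \<le> v x" "\<And>x. (0::real) < v x \<longleftrightarrow> x \<in> V"
    using cozero_function[OF UV(2)] by metis
  define k where "k = (\<lambda>x. max (f x - \<epsilon>) 0)"
  have k: "k \<in> test (U \<union> V)"
    unfolding k_def by (rule truncate_test[OF f \<epsilon>])
  \<comment> \<open>Positive everywhere, and equal to \<open>u + v\<close> wherever \<open>k\<close> is nonzero.\<close>
  define d where "d = (\<lambda>x. u x + v x + max (\<epsilon> - f x) 0)"
  have d: "0 < d x" for x
  proof (cases "x \<in> U \<union> V")
    case True
    then have "0 < u x + v x"
      using u(2,3)[of x] v(2,3)[of x] by (auto intro: add_pos_nonneg add_nonneg_pos)
    then show ?thesis by (auto simp: d_def intro: add_pos_nonneg)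
  next
    case False
    then show ?thesis
      using testD(5)[OF f] u(2)[of x] v(2)[of x] \<epsilon> by (simp add: d_def add_nonneg_pos)
  qed
  have contd: "continuous_on UNIV d"
    unfolding d_def using u(1) v(1) testD(2)[OF f] by (intro continuous_intros)
  have part: "(\<lambda>x. k x * (w x / d x)) \<in> test W"
    if w: "continuous_on UNIV w" "\<And>x. 0 \<le> w x" "\<And>x. (0::real) < w x \<longleftrightarrow> x \<in> W" "\<And>x. w x \<le> d x" for w W
  proof (rule testI)
    show "continuous_on UNIV (\<lambda>x. k x * (w x / d x))"
      using testD(2)[OF k] contd w(1) d by (intro continuous_intros) (auto simp: less_imp_neq[symmetric])
    fix x
    have "0 \<le> w x / d x" "w x / d x \<le> 1"
      using w(2,4)[of x] d[of x] by auto
    then show "0 \<le> k x * (w x / d x)" "k x * (w x / d x) \<le> 1"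
      using testD(3,4)[OF k, of x] by (blast intro: mult_nonneg_nonneg mult_le_one)+
    show "k x * (w x / d x) = 0" if "x \<notin> W"
      using w(2,3)[of x] that by simp
  qed
  have le: "u x \<le> d x" "v x \<le> d x" for x
    using u(2)[of x] v(2)[of x] by (auto simp: d_def)
  have "k x = k x * (u x / d x) + k x * (v x / d x)" for x
  proof (cases "k x = 0")
    case False
    then have "d x = u x + v x"
      by (auto simp: d_def k_def max_def split: if_splits)
    then have "u x / d x + v x / d x = 1"
      using d[of x] by (simp flip: add_divide_distrib)
    then show ?thesis
      by (metis distrib_left mult.right_neutral)
  qed simp
  then show ?thesis
    using part[OF u le(1)] part[OF v le(2)] by (intro that) (auto simp: k_def)
qed

lemma content_Un_le:
  assumes "open U" "open V"
  shows "content (U \<union> V) \<le> content U + content V"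
proof (rule content_le, rule field_le_epsilon)
  fix f and \<epsilon> :: real assume f: "f \<in> test (U \<union> V)" and \<epsilon>: "\<epsilon> > 0"
  obtain g h where gh: "g \<in> test U" "h \<in> test V" "\<And>x. max (f x - \<epsilon>) 0 = g x + h x"
    using test_split[OF f assms \<epsilon>] by metis
  have "L f \<le> L (\<lambda>x. g x + h x) + \<epsilon>"
    using truncate_test(2)[OF f \<epsilon>] by (simp add: gh(3))
  also have "\<dots> = L g + L h + \<epsilon>"
    using gh testD(1) by (simp add: L)
  also have "\<dots> \<le> content U + content V + \<epsilon>"
    using gh by (simp add: add_mono test_le_content)
  finally show "L f \<le> content U + content V + \<epsilon>" .
qed

lemma outer_le:
  assumes "open U" "A \<subseteq> U"
  shows "outer A \<le> content U"
  unfolding outer_def using assms content_nonneg by (intro cINF_lower bdd_belowI2[of _ 0]) auto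

lemma le_outer: "(\<And>U. open U \<Longrightarrow> A \<subseteq> U \<Longrightarrow> c \<le> content U) \<Longrightarrow> c \<le> outer A"
  unfolding outer_def by (intro cINF_greatest) auto

lemma outer_nonneg: "0 \<le> outer A"
  by (intro le_outer content_nonneg)

lemma outer_open: "open U \<Longrightarrow> outer U = content U"
  by (intro antisym outer_le le_outer content_mono) auto

lemma outer_mono: "A \<subseteq> C \<Longrightarrow> outer A \<le> outer C"
  by (intro le_outer outer_le) auto

lemma outer_approx:
  assumes "\<epsilon> > 0"
  obtains U where "open U" "A \<subseteq> U" "content U < outer A + \<epsilon>"
proof -
  have "\<not> outer A + \<epsilon> \<le> outer A" using assms by simp
  then show ?thesis using le_outer[of A "outer A + \<epsilon>"] that by (meson not_le)
qed

lemma outer_Un_le: "outer (A \<union> C) \<le> outer A + outer C"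
proof (rule field_le_epsilon)
  fix \<epsilon> :: real assume "\<epsilon> > 0"
  then have "\<epsilon> / 2 > 0" by simp
  obtain U where U: "open U" "A \<subseteq> U" "content U < outer A + \<epsilon> / 2"
    using outer_approx[OF \<open>\<epsilon> / 2 > 0\<close>] by metis
  obtain V where V: "open V" "C \<subseteq> V" "content V < outer C + \<epsilon> / 2"
    using outer_approx[OF \<open>\<epsilon> / 2 > 0\<close>] by metis
  have "outer (A \<union> C) \<le> content (U \<union> V)"
    using U V by (intro outer_le) auto
  also have "\<dots> \<le> content U + content V"
    using U V by (intro content_Un_le)
  finally show "outer (A \<union> C) \<le> outer A + outer C + \<epsilon>"
    using U V by simp
qed

text \<open>
  Subtracting from \<open>V\<close> only the closed set \<open>{x. \<epsilon> \<le> f x}\<close> leaves an open set \<open>W\<close>, and a function tested on \<open>W\<close>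
  may be added to the cut-off of \<open>f\<close> without exceeding \<open>1\<close>, since the cut-off vanishes on \<open>W\<close>.
\<close>

lemma content_split:
  assumes U: "open U" and V: "open V"
  shows "content (V \<inter> U) + outer (V - U) \<le> content V"
proof -
  have *: "L f + outer (V - U) \<le> content V" if f: "f \<in> test (V \<inter> U)" for f
  proof (rule field_le_epsilon)
    fix \<epsilon> :: real assume \<epsilon>: "\<epsilon> > 0"
    define W where "W = V \<inter> {x. f x < \<epsilon>}"
    define k where "k = (\<lambda>x. max (f x - \<epsilon>) 0)"
    have k: "k \<in> test (V \<inter> U)" and Lk: "L f \<le> L k + \<epsilon>"
      unfolding k_def using truncate_test[OF f \<epsilon>] by auto
    have W: "open W"
      unfolding W_def using V testD(2)[OF f] by (intro open_Int open_Collect_less continuous_intros)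
    have "V - U \<subseteq> W"
      using testD(5)[OF f] \<epsilon> by (auto simp: W_def)
    then have "outer (V - U) \<le> content W"
      by (rule outer_le[OF W])
    also have "\<dots> \<le> content V - L k"
    proof (rule content_le)
      fix g assume g: "g \<in> test W"
      have "(\<lambda>x. k x + g x) \<in> test V"
      proof (rule testI)
        show "continuous_on UNIV (\<lambda>x. k x + g x)"
          by (intro continuous_intros testD(2)[OF k] testD(2)[OF g])
        fix x
        show "0 \<le> k x + g x"
          using testD(3)[OF k] testD(3)[OF g] by (intro add_nonneg_nonneg)
        show "k x + g x \<le> 1"
        proof (cases "x \<in> W")
          case True
          then have "k x = 0" by (auto simp: W_def k_def)
          then show ?thesis using testD(4)[OF g] by simp
        qed (use testD(4)[OF k] testD(5)[OF g] in simp)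
        show "k x + g x = 0" if "x \<notin> V"
          using testD(5)[OF k, of x] testD(5)[OF g, of x] that by (simp add: W_def)
      qed
      then have "L (\<lambda>x. k x + g x) \<le> content V"
        by (rule test_le_content)
      then show "L g \<le> content V - L k"
        using testD(1)[OF k] testD(1)[OF g] by (simp add: L)
    qed
    finally show "L f + outer (V - U) \<le> content V + \<epsilon>"
      using Lk by simp
  qed
  have "content (V \<inter> U) \<le> content V - outer (V - U)"
    using * by (intro content_le) (simp add: algebra_simps)
  then show ?thesis by simp
qed

abbreviation Caratheodory_sets :: "'a set set" where
  "Caratheodory_sets \<equiv> lambda_system UNIV (Pow UNIV) (\<lambda>A. ennreal (outer A))"

lemma outer_empty: "outer {} = 0"
  by (simp add: outer_open content_empty)

lemma positive_outer: "positive (Pow UNIV) (\<lambda>A. ennreal (outer A))"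
  by (simp add: positive_def outer_empty)

text \<open>
  The splitting of open sets passes to arbitrary sets by outer approximation.  As the Caratheodory
  sets form an algebra on which \<open>outer\<close> is additive, this makes \<open>outer\<close> a charge on the algebra generated
  by the open sets.
\<close>

lemma open_Caratheodory:
  assumes "open U"
  shows "U \<in> Caratheodory_sets"
proof -
  have le: "outer (A \<inter> U) + outer (A - U) \<le> outer A" for A
  proof (rule le_outer)
    fix V assume V: "open V" "A \<subseteq> V"
    have "outer (A \<inter> U) + outer (A - U) \<le> content (V \<inter> U) + outer (V - U)"
      using V assms by (intro add_mono outer_le outer_mono) auto
    also have "\<dots> \<le> content V"
      by (rule content_split[OF assms V(1)])
    finally show "outer (A \<inter> U) + outer (A - U) \<le> content V" .
  qed
  have "outer (A \<inter> U) + outer (A - U) = outer A" for A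
    using outer_Un_le[of "A \<inter> U" "A - U"] le[of A] by (simp add: Int_Diff_Un)
  then show ?thesis
    unfolding algebra.lambda_system_eq[OF algebra_Pow]
    by (simp flip: ennreal_plus add: outer_nonneg)
qed

lemma outer_disjoint_Un:
  assumes "A \<in> Caratheodory_sets" "C \<in> Caratheodory_sets" "A \<inter> C = {}"
  shows "outer (A \<union> C) = outer A + outer C"
proof -
  have "ennreal (outer (A \<union> C)) = ennreal (outer A) + ennreal (outer C)"
    using algebra.lambda_system_additive[OF algebra_Pow, of UNIV "\<lambda>A. ennreal (outer A)"] assms
    by (auto simp: additive_def)
  then show ?thesis
    by (simp flip: ennreal_plus add: outer_nonneg)
qed

text \<open>
  Since \<open>{x. 1 - \<epsilon> < g x}\<close> is an open set that contains \<open>F\<close>, and \<open>(1 - \<epsilon>) * k \<le> g\<close> for every \<open>k\<close> tested on it.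
\<close>

lemma outer_le_functional:
  assumes g: "g \<in> bcontfun" and F: "\<And>x. indicator F x \<le> g x"
  shows "outer F \<le> L g"
proof (rule field_le_epsilon)
  fix e :: real assume "e > 0"
  \<comment> \<open>Any positive number at most \<open>e\<close> and below \<open>1\<close>.\<close>
  define \<epsilon> where "\<epsilon> = min e (1/2)"
  have \<epsilon>: "0 < \<epsilon>" "\<epsilon> < 1" "\<epsilon> \<le> e"
    using \<open>e > 0\<close> by (auto simp: \<epsilon>_def)
  have g0: "0 \<le> g x" for x
    using F[of x] by (cases "x \<in> F") auto
  define U where "U = {x. 1 - \<epsilon> < g x}"
  have U: "open U"
    unfolding U_def using g by (intro open_Collect_less continuous_intros) (simp add: bcontfun_def)
  have "1 \<le> g x" if "x \<in> F" for x
    using F[of x] that by simp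
  then have "F \<subseteq> U"
    using \<epsilon> by (force simp: U_def)
  then have "outer F \<le> content U"
    by (rule outer_le[OF U])
  also have "content U \<le> L g / (1 - \<epsilon>)"
  proof (rule content_le)
    fix k assume k: "k \<in> test U"
    have "(1 - \<epsilon>) * k x \<le> g x" for x
    proof (cases "x \<in> U")
      case True
      have "(1 - \<epsilon>) * k x \<le> (1 - \<epsilon>) * 1"
        using testD(4)[OF k] \<epsilon> by (intro mult_left_mono) auto
      then show ?thesis using True by (simp add: U_def)
    qed (use testD(5)[OF k] g0 in simp)
    then have "L (\<lambda>x. (1 - \<epsilon>) * k x) \<le> L g"
      by (intro L_mono scale_mem testD(1)[OF k] g)
    then have "(1 - \<epsilon>) * L k \<le> L g"
      by (simp only: normalized_positive_scale[OF normalized_positive testD(1)[OF k]])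
    then show "L k \<le> L g / (1 - \<epsilon>)"
      using \<epsilon> by (simp add: pos_le_divide_eq mult.commute)
  qed
  finally have "(1 - \<epsilon>) * outer F \<le> L g"
    using \<epsilon> by (simp add: field_simps)
  moreover have "outer F \<le> 1"
    using outer_le[of UNIV F] by (simp add: content_UNIV)
  then have "\<epsilon> * outer F \<le> \<epsilon>"
    using \<epsilon> by (intro mult_left_le) auto
  moreover have "outer F = (1 - \<epsilon>) * outer F + \<epsilon> * outer F"
    by (simp add: algebra_simps)
  ultimately show "outer F \<le> L g + e"
    using \<epsilon>(3) by linarith
qed

lemma prob_charge_outer:
  assumes M: "algebra UNIV M" "M \<subseteq> Caratheodory_sets"
  shows "prob_charge M (restrict outer M)"
proof -
  interpret algebra UNIV M by fact
  have "additive M (restrict outer M)"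
    using M(2) by (auto simp: additive_def outer_disjoint_Un subset_eq)
  then have "restrict outer M \<in> prob_charges M"
    by (auto simp: prob_charges_def outer_nonneg outer_open content_UNIV)
  then show ?thesis by unfold_locales
qed

text \<open>
  Outer approximation is built into \<open>outer\<close>, and inner approximation of \<open>A\<close> is outer approximation of
  its complement.
\<close>

theorem regular_representation:
  assumes M: "algebra UNIV M" "{U. open U} \<subseteq> M" "M \<subseteq> Caratheodory_sets"
  obtains \<mu> where "\<mu> \<in> prob_charges M" "regular_charge M \<mu>"
    "\<And>f. f \<in> bcontfun \<Longrightarrow> L f = charge_integral M \<mu> f"
proof (rule that)
  let ?\<mu> = "restrict outer M"
  interpret prob_charge M ?\<mu>
    by (rule prob_charge_outer[OF M(1,3)])
  show "?\<mu> \<in> prob_charges M"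
    by (rule charge)
  have op: "U \<in> M" if "open U" for U
    using M(2) that by auto
  have cl: "F \<in> M" if "closed F" for F
    using compl_sets[OF op[of "- F"]] that by (simp add: Compl_eq_Diff_UNIV[symmetric] open_Compl)
  show "regular_charge M ?\<mu>"
    unfolding regular_charge_def
  proof (intro ballI allI impI)
    fix A and \<epsilon> :: real assume A: "A \<in> M" and "\<epsilon> > 0"
    then have "\<epsilon> / 2 > 0" by simp
    have A': "- A \<in> M"
      using compl_sets[OF A] by (simp add: Compl_eq_Diff_UNIV)
    obtain G where G: "open G" "A \<subseteq> G" "content G < outer A + \<epsilon> / 2"
      using outer_approx[OF \<open>\<epsilon> / 2 > 0\<close>] by metis
    obtain H where H: "open H" "- A \<subseteq> H" "content H < outer (- A) + \<epsilon> / 2"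
      using outer_approx[OF \<open>\<epsilon> / 2 > 0\<close>] by metis
    have F: "- H \<subseteq> A" using H(2) by auto
    have "?\<mu> (G - - H) = ?\<mu> G - ?\<mu> (- H)"
      using G F by (intro Diff_eq op cl closed_Compl H) auto
    also have "?\<mu> (- H) = 1 - ?\<mu> H"
      using Diff_eq[of UNIV H] op[OF H(1)] by (simp add: Compl_eq_Diff_UNIV total del: restrict_apply)
    also have "?\<mu> G - (1 - ?\<mu> H) < ?\<mu> A + ?\<mu> (- A) + \<epsilon> - 1"
      using G H A A' op by (simp add: outer_open)
    also have "?\<mu> A + ?\<mu> (- A) = 1"
      using disjoint_Un[OF A A'] total by simp
    finally have "?\<mu> (G - - H) < \<epsilon>" by simp
    moreover have "closed (- H)"
      using H(1) by (rule closed_Compl)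
    ultimately show "\<exists>F G. closed F \<and> open G \<and> F \<subseteq> A \<and> A \<subseteq> G \<and> ?\<mu> (G - F) < \<epsilon>"
      using G F by blast
  qed
  fix f :: "'a \<Rightarrow> real" assume f: "f \<in> bcontfun"
  have cont: "continuous_on UNIV f" using f by (simp add: bcontfun_def)
  have closed: "closed {x. r \<le> f x}" for r
    by (intro closed_Collect_le continuous_intros cont)
  show "L f = charge_integral M ?\<mu> f"
  proof (rule charge_integral_eqI[OF prob_charge_outer[OF M(1,3)] normalized_positive f])
    fix r
    show "{x. r \<le> f x} \<in> M"
      by (rule cl[OF closed])
    fix g :: "'a \<Rightarrow> real" assume g: "g \<in> bcontfun"
    show "?\<mu> {x. r \<le> f x} \<le> L g" if "\<And>x. indicator {x. r \<le> f x} x \<le> g x"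
      using outer_le_functional[OF g that] cl[OF closed] by simp
    show "L g \<le> ?\<mu> {x. r \<le> f x}" if "\<And>x. 0 \<le> g x" "\<And>x. g x \<le> indicator {x. r < f x} x"
    proof -
      have "g \<in> test {x. r < f x}"
        using g that by (simp add: test_def)
      then have "L g \<le> content {x. r < f x}"
        by (rule test_le_content)
      also have "\<dots> = outer {x. r < f x}"
        by (intro outer_open[symmetric] open_Collect_less continuous_intros cont)
      also have "\<dots> \<le> outer {x. r \<le> f x}"
        by (intro outer_mono) auto
      finally show ?thesis using cl[OF closed] by simp
    qed
  qed
qed

lemma algebra_Caratheodory: "algebra UNIV Caratheodory_sets"
  by (intro algebra.lambda_system_algebra algebra_Pow positive_outer)

lemma content_finite_UN_le:
  "finite I \<Longrightarrow> (\<And>i. i \<in> I \<Longrightarrow> open (U i)) \<Longrightarrow> content (\<Union>i\<in>I. U i) \<le> (\<Sum>i\<in>I. content (U i))"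
proof (induction I rule: finite_induct)
  case (insert i I)
  have "content (U i \<union> (\<Union>j\<in>I. U j)) \<le> content (U i) + content (\<Union>j\<in>I. U j)"
    using insert.prems by (intro content_Un_le open_UN) auto
  with insert show ?case by fastforce
qed (simp add: content_empty)

text \<open>
  Compactness enters here: the closed set \<open>{x. \<epsilon> / 2 \<le> f x}\<close> is then covered by finitely
  many of the sets \<open>U i\<close>, so that finite subadditivity suffices.
\<close>

lemma content_countable_UN_le:
  fixes U :: "nat \<Rightarrow> 'a set"
  assumes X: "compact (UNIV :: 'a set)" and U: "\<And>i. open (U i)" and \<epsilon>: "\<epsilon> > 0"
  obtains n where "content (\<Union>i. U i) \<le> (\<Sum>i<n. content (U i)) + \<epsilon>"
proof -
  have "\<epsilon> / 2 > 0" using \<epsilon> by simp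
  have "\<not> content (\<Union>i. U i) \<le> content (\<Union>i. U i) - \<epsilon> / 2" using \<epsilon> by simp
  then obtain f where f: "f \<in> test (\<Union>i. U i)" "content (\<Union>i. U i) - \<epsilon> / 2 < L f"
    using content_le by (meson not_le)
  have "closed {x. \<epsilon> / 2 \<le> f x}"
    by (intro closed_Collect_le continuous_intros testD(2)[OF f(1)])
  then have "compact {x. \<epsilon> / 2 \<le> f x}"
    using compact_Int_closed[OF X] by simp
  moreover have "{x. \<epsilon> / 2 \<le> f x} \<subseteq> (\<Union>i. U i)"
    using testD(5)[OF f(1)] \<epsilon> by fastforce
  ultimately obtain I where I: "finite I" "{x. \<epsilon> / 2 \<le> f x} \<subseteq> (\<Union>i\<in>I. U i)"
    using compactE_image[of "{x. \<epsilon> / 2 \<le> f x}" UNIV U] U by (metis (no_types))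
  obtain n where n: "I \<subseteq> {..<n}"
    using finite_nat_iff_bounded I(1) by auto
  define k where "k = (\<lambda>x. max (f x - \<epsilon> / 2) 0)"
  note tr = truncate_test[OF f(1) \<open>\<epsilon> / 2 > 0\<close>, folded k_def]
  have "k \<in> test (\<Union>i<n. U i)"
  proof (rule testI)
    fix x assume "x \<notin> (\<Union>i<n. U i)"
    then have "\<not> \<epsilon> / 2 \<le> f x" using I n by blast
    then show "k x = 0" by (simp add: k_def)
  qed (use testD[OF tr(1)] in auto)
  then have "L k \<le> content (\<Union>i<n. U i)"
    by (rule test_le_content)
  also have "\<dots> \<le> (\<Sum>i<n. content (U i))"
    using U by (intro content_finite_UN_le) auto
  finally show ?thesis
    using f(2) tr(2) by (intro that[of n]) simp
qed

text \<open>
  Cover \<open>A i\<close> by an open set whose content exceeds \<open>outer (A i)\<close> by at most the \<open>i\<close>-th term of a geometric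
  series with sum \<open>e / 2\<close>; the other half of \<open>e\<close> pays for the passage to finitely many sets.
\<close>

lemma outer_measure_space_outer:
  assumes X: "compact (UNIV :: 'a set)"
  shows "outer_measure_space (Pow UNIV) (\<lambda>A. ennreal (outer A))"
  unfolding outer_measure_space_def
proof (intro conjI positive_outer)
  show "increasing (Pow UNIV) (\<lambda>A. ennreal (outer A))"
    by (auto simp: increasing_def intro!: ennreal_leI outer_mono)
  show "countably_subadditive (Pow UNIV) (\<lambda>A. ennreal (outer A))"
    unfolding countably_subadditive_def
  proof (intro allI impI)
    fix A :: "nat \<Rightarrow> 'a set"
    show "ennreal (outer (\<Union>i. A i)) \<le> (\<Sum>i. ennreal (outer (A i)))"
    proof (rule ennreal_le_epsilon)
      fix e :: real assume e: "e > 0"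
      have "\<exists>V. open V \<and> A i \<subseteq> V \<and> content V < outer (A i) + e / 2 * (1/2) ^ Suc i" for i
      proof -
        have "e / 2 * (1/2) ^ Suc i > 0" using e by simp
        from outer_approx[OF this, of "A i"] show ?thesis by metis
      qed
      then obtain U where U: "\<And>i. open (U i)" "\<And>i. A i \<subseteq> U i"
          "\<And>i. content (U i) < outer (A i) + e / 2 * (1/2) ^ Suc i"
        by metis
      have "e / 2 > 0" using e by simp
      obtain n where n: "content (\<Union>i. U i) \<le> (\<Sum>i<n. content (U i)) + e / 2"
        by (rule content_countable_UN_le[OF X U(1) \<open>e / 2 > 0\<close>])
      have "(\<Sum>i<n. (1/2::real) ^ Suc i) \<le> 1"
        using power_half_series by (intro sum_le_suminf[of "\<lambda>i. (1/2::real) ^ Suc i", THEN order_trans])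
          (auto simp: sums_iff)
      then have geo: "(\<Sum>i<n. e / 2 * (1/2) ^ Suc i) \<le> e / 2"
        unfolding sum_distrib_left[symmetric] using e by (simp add: mult_left_le)
      have "outer (\<Union>i. A i) \<le> content (\<Union>i. U i)"
        using U by (intro outer_le open_UN) auto
      also have "\<dots> \<le> (\<Sum>i<n. outer (A i) + e / 2 * (1/2) ^ Suc i) + e / 2"
        using n sum_mono[of "{..<n}" "\<lambda>i. content (U i)" "\<lambda>i. outer (A i) + e / 2 * (1/2) ^ Suc i"]
          less_imp_le[OF U(3)] by simp
      also have "\<dots> \<le> (\<Sum>i<n. outer (A i)) + e"
        using geo by (simp add: sum.distrib)
      finally have "ennreal (outer (\<Union>i. A i)) \<le> ennreal ((\<Sum>i<n. outer (A i)) + e)"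
        by (rule ennreal_leI)
      also have "\<dots> = (\<Sum>i<n. ennreal (outer (A i))) + ennreal e"
        using e by (simp add: ennreal_plus sum_nonneg outer_nonneg sum_ennreal)
      also have "\<dots> \<le> (\<Sum>i. ennreal (outer (A i))) + ennreal e"
        by (intro add_right_mono sum_le_suminf) auto
      finally show "ennreal (outer (\<Union>i. A i)) \<le> (\<Sum>i. ennreal (outer (A i))) + ennreal e" .
    qed
  qed
qed

lemma borel_Caratheodory:
  assumes "compact (UNIV :: 'a set)"
  shows "sets borel \<subseteq> Caratheodory_sets"
proof -
  have "sigma_algebra UNIV Caratheodory_sets"
    using sigma_algebra.caratheodory_lemma[OF sigma_algebra_Pow outer_measure_space_outer[OF assms]]
    by (simp add: measure_space_def)
  then have "sigma_sets UNIV {U. open U} \<subseteq> Caratheodory_sets"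
    using open_Caratheodory by (intro sigma_algebra.sigma_sets_subset) auto
  then show ?thesis by (simp add: borel_def)
qed

end

section \<open>Unique tangent functionals\<close>

text \<open>
  For \<open>F \<subseteq> A \<subseteq> G'\<close> with \<open>F\<close> closed and \<open>G'\<close> open, a Urysohn function \<open>f\<close> yields
  \<open>\<alpha> F \<le> \<integral>f d\<alpha> = \<integral>f d\<beta> \<le> \<beta> G'\<close>.  Choose \<open>F\<close> by regularity of \<open>\<alpha>\<close> and \<open>G'\<close> by regularity of \<open>\<beta>\<close>,
  where \<open>\<alpha>\<close> and \<open>\<beta>\<close> are the two charges in either order.
\<close>

lemma regular_charges_eqI:
  fixes M :: "'a::metric_space set set"
  assumes M: "algebra UNIV M" "{U. open U} \<subseteq> M"
    and \<mu>: "\<mu> \<in> prob_charges M" "regular_charge M \<mu>"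
    and \<nu>: "\<nu> \<in> prob_charges M" "regular_charge M \<nu>"
    and eq: "\<And>f. f \<in> bcontfun \<Longrightarrow> charge_integral M \<mu> f = charge_integral M \<nu> f"
  shows "\<mu> = \<nu>"
proof -
  interpret algebra UNIV M by fact
  have op: "U \<in> M" if "open U" for U
    using M(2) that by auto
  have cl: "F \<in> M" if "closed F" for F
    using compl_sets[OF op[of "- F"]] that by (simp add: Compl_eq_Diff_UNIV[symmetric] open_Compl)
  have le: "\<alpha> A \<le> \<beta> A"
    if \<alpha>: "\<alpha> \<in> prob_charges M" "regular_charge M \<alpha>"
      and \<beta>: "\<beta> \<in> prob_charges M" "regular_charge M \<beta>"
      and eq: "\<And>f. f \<in> bcontfun \<Longrightarrow> charge_integral M \<alpha> f = charge_integral M \<beta> f"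
      and A: "A \<in> M" for \<alpha> \<beta> A
  proof (rule field_le_epsilon)
    interpret \<alpha>: prob_charge M \<alpha>
      using M(1) \<alpha>(1) by (simp add: prob_charge_def prob_charge_axioms_def)
    interpret \<beta>: prob_charge M \<beta>
      using M(1) \<beta>(1) by (simp add: prob_charge_def prob_charge_axioms_def)
    fix \<epsilon> :: real assume "\<epsilon> > 0"
    then have e: "\<epsilon> / 2 > 0" by simp
    obtain F G where FG: "closed F" "open G" "F \<subseteq> A" "A \<subseteq> G" "\<alpha> (G - F) < \<epsilon> / 2"
      using \<alpha>(2) A e unfolding regular_charge_def by metis
    obtain F' G' where FG': "closed F'" "open G'" "F' \<subseteq> A" "A \<subseteq> G'" "\<beta> (G' - F') < \<epsilon> / 2"
      using \<beta>(2) A e unfolding regular_charge_def by metis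
    have "F \<subseteq> G'" using FG FG' by auto
    then obtain f where f: "f \<in> bcontfun" "\<And>x. indicator F x \<le> f x" "\<And>x. f x \<le> (indicator G' x :: real)"
      using Urysohn_bcontfun[OF FG(1) FG'(2)] by metis
    have bdd: "bounded (range f)" using f(1) by (simp add: bcontfun_def)
    have "\<alpha> A - \<alpha> F = \<alpha> (A - F)"
      using FG A cl by (intro \<alpha>.Diff_eq[symmetric]) auto
    also have "\<dots> \<le> \<alpha> (G - F)"
      using FG A cl op by (intro \<alpha>.mono Diff) auto
    finally have "\<alpha> A \<le> \<alpha> F + \<epsilon> / 2" using FG(5) by simp
    also have "\<alpha> F \<le> charge_integral M \<alpha> f"
      by (rule \<alpha>.le_charge_integral_of_set[OF bdd cl[OF FG(1)] f(2)])
    also have "\<dots> \<le> \<beta> G'"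
      unfolding eq[OF f(1)] by (rule \<beta>.charge_integral_le_of_set[OF bdd op[OF FG'(2)] f(3)])
    also have "\<beta> G' \<le> \<beta> A + \<epsilon> / 2"
    proof -
      have "\<beta> G' - \<beta> A = \<beta> (G' - A)"
        using FG' A op by (intro \<beta>.Diff_eq[symmetric]) auto
      also have "\<dots> \<le> \<beta> (G' - F')"
        using FG' A cl op by (intro \<beta>.mono Diff) auto
      finally show ?thesis using FG'(5) by simp
    qed
    finally show "\<alpha> A \<le> \<beta> A + \<epsilon>" by simp
  qed
  have "\<mu> A = \<nu> A" if "A \<in> M" for A
    using le[OF \<mu> \<nu> eq that] le[OF \<nu> \<mu> eq[symmetric] that] by simp
  moreover have "\<mu> \<in> extensional M" "\<nu> \<in> extensional M"
    using \<mu>(1) \<nu>(1) by (auto simp: prob_charges_def)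
  ultimately show ?thesis
    by (auto intro: extensionalityI)
qed

lemma algebra_hull: "algebra UNIV (algebra UNIV hull S)"
proof (rule hull_in)
  fix C :: "'a set set set" assume "Ball C (algebra UNIV)"
  then show "algebra UNIV (\<Inter>C)"
    by (auto simp: algebra_iff_Un)
qed

text \<open>
  The algebra \<open>M\<close> is left open so that the statement covers the algebra generated by the open sets
  and, on a compact space, the Borel sets.
\<close>

theorem gateaux_iff_unique_regular_charge:
  fixes M :: "'a::metric_space set set"
  assumes \<Gamma>: "pressure_function bcontfun \<Gamma>" "\<phi> \<in> bcontfun"
    and M: "algebra UNIV M" "{U. open U} \<subseteq> M"
    and Caratheodory: "\<And>L. bcontfun_functional L \<Longrightarrow> M \<subseteq> bcontfun_functional.Caratheodory_sets L"
  shows "gateaux_differentiable_at bcontfun \<Gamma> \<phi> \<longleftrightarrow>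
    (\<exists>!\<mu>. \<mu> \<in> {\<mu> \<in> {\<mu> \<in> prob_charges M. regular_charge M \<mu>}.
      \<forall>\<psi>\<in>bcontfun. \<Gamma> (\<lambda>x. \<phi> x + \<psi> x) - \<Gamma> \<phi> \<ge> charge_integral M \<mu> \<psi>})"
proof -
  interpret pressure bcontfun \<Gamma> \<phi>
    using bounded_function_space_bcontfun \<Gamma> by (simp add: pressure_def pressure_axioms_def)
  show ?thesis
  proof (rule gateaux_iff_unique_tangent)
    fix \<mu> and \<psi> :: "'a \<Rightarrow> real" and t :: real
    assume \<mu>: "\<mu> \<in> {\<mu> \<in> prob_charges M. regular_charge M \<mu>}" and \<psi>: "\<psi> \<in> bcontfun"
    interpret prob_charge M \<mu>
      using M(1) \<mu> by (simp add: prob_charge_def prob_charge_axioms_def)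
    have cont: "continuous_on UNIV \<psi>" using \<psi> by (simp add: bcontfun_def)
    have "{x. r \<le> \<psi> x} \<in> M" for r
    proof -
      have "open {x. \<psi> x < r}"
        by (intro open_Collect_less continuous_intros cont)
      then have "UNIV - {x. \<psi> x < r} \<in> M"
        using M(2) by (intro compl_sets) auto
      moreover have "UNIV - {x. \<psi> x < r} = {x. r \<le> \<psi> x}" by auto
      ultimately show ?thesis by simp
    qed
    then show "charge_integral M \<mu> (\<lambda>x. t * \<psi> x) = t * charge_integral M \<mu> \<psi>"
      by (intro charge_integral_scale bounded \<psi>)
  next
    fix L assume "normalized_positive L"
    then interpret L: bcontfun_functional L
      by unfold_locales
    show "\<exists>\<mu>\<in>{\<mu> \<in> prob_charges M. regular_charge M \<mu>}. \<forall>f\<in>bcontfun. L f = charge_integral M \<mu> f"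
    proof (rule L.regular_representation[OF M Caratheodory[OF L.bcontfun_functional_axioms]])
      fix \<mu>
      assume "\<mu> \<in> prob_charges M" "regular_charge M \<mu>"
        "\<And>f. f \<in> bcontfun \<Longrightarrow> L f = charge_integral M \<mu> f"
      then show ?thesis by blast
    qed
  next
    fix \<mu> \<nu>
    assume "\<mu> \<in> {\<mu> \<in> prob_charges M. regular_charge M \<mu>}" "\<nu> \<in> {\<mu> \<in> prob_charges M. regular_charge M \<mu>}"
      "\<And>f. f \<in> bcontfun \<Longrightarrow> charge_integral M \<mu> f = charge_integral M \<nu> f"
    then show "\<mu> = \<nu>"
      by (intro regular_charges_eqI[OF M]) auto
  qed
qed

lemma bounded_function_space_Bm:
  "bounded_function_space (carrier_of Bm :: ('a::metric_space \<Rightarrow> real) set)"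
proof
  fix f g :: "'a \<Rightarrow> real" and c
  assume f: "f \<in> carrier_of Bm"
  show "(\<lambda>x. c * f x) \<in> carrier_of Bm"
    using f bounded_scaling[of "range f" c] by (auto simp: image_image)
  show "(\<lambda>x. min (f x) c) \<in> carrier_of Bm"
    using f bounded_range_min[of f c] by auto
  show "bounded (range f)" using f by simp
  assume "g \<in> carrier_of Bm"
  then show "(\<lambda>x. f x + g x) \<in> carrier_of Bm"
    using f by (auto intro: bounded_plus_comp)
qed (auto simp: image_def)

text \<open>
  All indicators of Borel sets are available as test functions, so a functional \<open>L\<close> is represented by
  \<open>A \<mapsto> L (indicator A)\<close> and by no other charge.
\<close>

theorem gateaux_iff_unique_borel_charge:
  fixes \<Gamma> :: "('a::metric_space \<Rightarrow> real) \<Rightarrow> real"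
  assumes \<Gamma>: "pressure_function (carrier_of Bm) \<Gamma>" "\<phi> \<in> carrier_of Bm"
  shows "gateaux_differentiable_at (carrier_of Bm) \<Gamma> \<phi> \<longleftrightarrow>
    (\<exists>!\<mu>. \<mu> \<in> {\<mu> \<in> prob_charges (sets borel).
      \<forall>\<psi>\<in>carrier_of Bm. \<Gamma> (\<lambda>x. \<phi> x + \<psi> x) - \<Gamma> \<phi> \<ge> charge_integral (sets borel) \<mu> \<psi>})"
proof -
  let ?B = "carrier_of Bm :: ('a \<Rightarrow> real) set"
  let ?M = "sets borel :: 'a set set"
  interpret pressure ?B \<Gamma> \<phi>
    using bounded_function_space_Bm \<Gamma> by (simp only: pressure_def pressure_axioms_def)
  have alg: "algebra UNIV ?M"
    using sets.algebra_axioms[of "borel :: 'a measure"] by simp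
  have meas: "{x. r \<le> \<psi> x} \<in> ?M" if "\<psi> \<in> ?B" for r and \<psi> :: "'a \<Rightarrow> real"
  proof -
    have [measurable]: "\<psi> \<in> borel_measurable borel" using that by simp
    have "{x \<in> space borel. r \<le> \<psi> x} \<in> ?M" by measurable
    then show ?thesis by simp
  qed
  have ind: "indicator A \<in> ?B" if "A \<in> ?M" for A
  proof -
    have "bounded (range (indicator A :: 'a \<Rightarrow> real))"
      by (rule boundedI[of _ 1]) (auto simp: indicator_def)
    then show ?thesis using that by simp
  qed
  show ?thesis
  proof (rule gateaux_iff_unique_tangent)
    fix \<mu> and \<psi> :: "'a \<Rightarrow> real" and t :: real
    assume \<mu>: "\<mu> \<in> prob_charges ?M" and \<psi>: "\<psi> \<in> ?B"
    interpret prob_charge ?M \<mu>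
      using alg \<mu> by (simp add: prob_charge_def prob_charge_axioms_def)
    show "charge_integral ?M \<mu> (\<lambda>x. t * \<psi> x) = t * charge_integral ?M \<mu> \<psi>"
      by (intro charge_integral_scale bounded \<psi> meas)
  next
    fix L assume L: "normalized_positive L"
    define \<mu> where "\<mu> = restrict (\<lambda>A. L (indicator A)) ?M"
    have "additive ?M \<mu>"
      unfolding additive_def
    proof (intro ballI impI)
      fix A C assume AC: "A \<in> ?M" "C \<in> ?M" "A \<inter> C = {}"
      have "indicator (A \<union> C) = (\<lambda>x. indicator A x + indicator C x :: real)"
        using AC(3) by (auto simp: indicator_def fun_eq_iff)
      then show "\<mu> (A \<union> C) = \<mu> A + \<mu> C"
        using AC normalized_positive_add[OF L ind[OF AC(1)] ind[OF AC(2)]] by (simp add: \<mu>_def)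
    qed
    moreover have "0 \<le> L (indicator A)" if "A \<in> ?M" for A
      using L ind[OF that] by (simp add: normalized_positive_def del: carrier_of.simps)
    moreover have "L (indicator UNIV) = 1"
      using L by (simp add: normalized_positive_def indicator_def[abs_def] del: carrier_of.simps)
    ultimately have \<mu>: "\<mu> \<in> prob_charges ?M"
      by (auto simp: prob_charges_def \<mu>_def)
    have "L f = charge_integral ?M \<mu> f" if f: "f \<in> ?B" for f
    proof (rule charge_integral_eqI[OF _ L f meas[OF f]])
      show "prob_charge ?M \<mu>"
        using alg \<mu> by (simp add: prob_charge_def prob_charge_axioms_def)
      fix r g assume g: "g \<in> ?B"
      let ?A = "{x. r \<le> f x}"
      show "\<mu> ?A \<le> L g" if "\<And>x. indicator ?A x \<le> g x"
        using normalized_positive_mono[OF L ind[OF meas[OF f]] g that] meas[OF f] by (simp add: \<mu>_def)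
      show "L g \<le> \<mu> ?A" if "\<And>x. g x \<le> indicator {x. r < f x} x"
      proof -
        have "g x \<le> indicator ?A x" for x
          using that[of x] by (rule order_trans) (auto simp: indicator_def)
        from normalized_positive_mono[OF L g ind[OF meas[OF f]] this]
        show ?thesis using meas[OF f] by (simp add: \<mu>_def)
      qed
    qed
    with \<mu> show "\<exists>\<mu>\<in>prob_charges ?M. \<forall>f\<in>?B. L f = charge_integral ?M \<mu> f"
      by blast
  next
    fix \<mu> \<nu>
    assume \<mu>: "\<mu> \<in> prob_charges ?M" and \<nu>: "\<nu> \<in> prob_charges ?M"
      and eq: "\<And>f. f \<in> ?B \<Longrightarrow> charge_integral ?M \<mu> f = charge_integral ?M \<nu> f"
    have val: "charge_integral ?M \<alpha> (indicator A) = \<alpha> A"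
      if "\<alpha> \<in> prob_charges ?M" "A \<in> ?M" for \<alpha> A
    proof -
      interpret prob_charge ?M \<alpha>
        using alg that(1) by (simp add: prob_charge_def prob_charge_axioms_def)
      show ?thesis
        using bounded[OF ind[OF that(2)]] that(2)
        by (intro antisym le_charge_integral_of_set charge_integral_le_of_set) auto
    qed
    have "\<mu> A = \<nu> A" if "A \<in> ?M" for A
      using eq[OF ind[OF that]] val[OF \<mu> that] val[OF \<nu> that] by simp
    moreover have "\<mu> \<in> extensional ?M" "\<nu> \<in> extensional ?M"
      using \<mu> \<nu> by (auto simp: prob_charges_def)
    ultimately show "\<mu> = \<nu>"
      by (auto intro: extensionalityI)
  qed
qed

text \<open>
  Translation invariance puts the constant \<open>1\<close> into the space, and its support is the whole space.
\<close>

lemma compact_if_pressure_on_Cc: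
  assumes "pressure_function (carrier_of Cc) (\<Gamma> :: ('a::metric_space \<Rightarrow> real) \<Rightarrow> real)"
  shows "compact (UNIV :: 'a set)"
proof -
  have "(\<lambda>x :: 'a. 0) \<in> carrier_of Cc" by simp
  moreover have "\<forall>f\<in>carrier_of Cc. \<forall>c. (\<lambda>x :: 'a. f x + c) \<in> carrier_of Cc"
    using assms unfolding pressure_function_def by blast
  ultimately have "\<forall>c. (\<lambda>x :: 'a. 0 + c) \<in> carrier_of Cc"
    by (rule bspec[rotated])
  then have "(\<lambda>x :: 'a. 0 + 1) \<in> carrier_of Cc"
    by (rule spec)
  then show ?thesis by simp
qed

lemma Cc_eq_bcontfun:
  assumes "compact (UNIV :: 'a::metric_space set)"
  shows "carrier_of Cc = (bcontfun :: ('a \<Rightarrow> real) set)"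
proof -
  have "bounded (range f)" if "continuous_on UNIV f" for f :: "'a \<Rightarrow> real"
    using compact_continuous_image[OF that assms] by (rule compact_imp_bounded)
  moreover have "compact (closure {x. f x \<noteq> 0})" for f :: "'a \<Rightarrow> real"
    using compact_Int_closed[OF assms, of "closure {x. f x \<noteq> 0}"] by simp
  ultimately show ?thesis
    by (auto simp: bcontfun_def)
qed

theorem corollary4:
  fixes S :: fun_space
    and \<Gamma> :: "('a::metric_space \<Rightarrow> real) \<Rightarrow> real"
    and \<phi> :: "'a \<Rightarrow> real"
  assumes "pressure_function (carrier_of S) \<Gamma>"
    and "\<phi> \<in> carrier_of S"
  shows "gateaux_differentiable_at (carrier_of S) \<Gamma> \<phi> \<longleftrightarrow>
         (\<exists>!\<mu>. \<mu> \<in> tangent_functionals S \<Gamma> \<phi>)"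
proof (cases S)
  case Bm
  show ?thesis
    using gateaux_iff_unique_borel_charge[of \<Gamma> \<phi>] assms
    unfolding Bm tangent_functionals_def Pa_def by simp
next
  case Cb
  let ?M = "domain_of Cb :: 'a set set"
  have M: "algebra UNIV ?M" "{U. open U} \<subseteq> ?M"
    by (simp_all add: algebra_hull hull_subset)
  have "?M \<subseteq> bcontfun_functional.Caratheodory_sets L" if "bcontfun_functional L"
    for L :: "('a \<Rightarrow> real) \<Rightarrow> real"
  proof -
    interpret bcontfun_functional L by fact
    have "algebra UNIV hull {U. open U} \<subseteq> Caratheodory_sets"
      using open_Caratheodory by (intro hull_minimal algebra_Caratheodory) auto
    then show ?thesis by simp
  qed
  then show ?thesis
    using gateaux_iff_unique_regular_charge[of \<Gamma> \<phi>, OF _ _ M] assms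
    unfolding Cb tangent_functionals_def Pa_def by simp
next
  case Cc
  have X: "compact (UNIV :: 'a set)"
    using compact_if_pressure_on_Cc assms(1) unfolding Cc .
  let ?M = "sets borel :: 'a set set"
  have M: "algebra UNIV ?M" "{U. open U} \<subseteq> ?M"
    using sets.algebra_axioms[of "borel :: 'a measure"] by auto
  have "?M \<subseteq> bcontfun_functional.Caratheodory_sets L" if "bcontfun_functional L"
    for L :: "('a \<Rightarrow> real) \<Rightarrow> real"
    using bcontfun_functional.borel_Caratheodory[OF that X] .
  then show ?thesis
    using gateaux_iff_unique_regular_charge[of \<Gamma> \<phi>, OF _ _ M] assms
    unfolding Cc tangent_functionals_def Pa_def Cc_eq_bcontfun[OF X] by simp
qed

end
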